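(* Let $c>0$ and $d\ge0$, let $T$ be the weighted random spanning tree of the enhanced helix-3-graph $G^{H_3'}$ with edge weights $1$ on the edges $h_m$, $c$ on the edges $z_m$ and $d$ on the edges $g_m$, and let $X_m=\mathbf{1}_{\{z_m\in T\}}$, $m\in\mathbb{Z}$. Then $X=(X_m)_{m\in\mathbb{Z}}$ is a determinantal point process with (real-valued symmetric Toeplitz) matrix $A_{k,l}=\widehat f(l-k)$ given by $$\widehat f(m)=\frac{x_1}{g'(x_1)}\,x_1^{|m|}+\frac{x_2}{g'(x_2)}\,x_2^{|m|},\qquad m\in\mathbb{Z},$$ where $$g(x)=c^{-1}\big[x^4+(d+2)x^3+(c+2d+3)x^2+(d+2)x+1\big]$$ and $$x_1=\tfrac14\big(-d-2+\sqrt{d^2-4d-4c}\big)+\tfrac14\sqrt{\big(-d-2+\sqrt{d^2-4d-4c}\big)^2-16}$$ and $$x_2=\tfrac14\big(-d-2-\sqrt{d^2-4d-4c}\big)+\tfrac14\sqrt{\big(-d-2-\sqrt{d^2-4d-4c}\big)^2-16}$$ are the two roots of $g$ in $\{z\in\mathbb{C}:|z|<1\}$. The Fourier transform $f$ of $\widehat f$ equals $$f(x)=\frac{c}{(c+2d+3)+2(d+2)\cos(2\pi x)+2\cos(4\pi x)}.$$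
   Context: Enhanced helix-3-graph $G^{H_3'}$: vertex set $\mathbb{Z}$, edges $z_m=\{m-1,m\}$, $h_m=\{m-3,m\}$ and $g_m=\{m-2,m\}$ for $m\in\mathbb{Z}$. The weight of a spanning tree is the product of the weights of its edges. The weighted spanning tree measure on $G^{H_3'}$ is the limit as $n\to\infty$ of the measures on spanning trees of the subgraph induced by $\{-n,\dots,n\}$ under which each tree has probability proportional to its weight (the limit exists, in the sense of convergence of probabilities of events depending on finitely many edges, and is concentrated on spanning trees of $G^{H_3'}$). A $\{0,1\}^{\mathbb{Z}}$-valued process $X$ is a determinantal point process with matrix $A$ (Hermitian, indexed by $\mathbb{Z}$) if $\mathbf{P}[X_s=1\text{ for all }s\in S]=\det((A_{ij})_{i,j\in S})$ for all finite $S\subset\mathbb{Z}$. The Fourier transform of $\widehat f$ is the function $f:[0,1]\to[0,1]$ with $\widehat f(k)=\int_0^1f(x)e^{-2\pi ikx}\,dx$ for all $k\in\mathbb{Z}$.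
   Formalization: The displayed formula for f̂(m) and the distinctness of x_1, x_2 are asserted only when d²−4d−4c≠0; when it is 0, x_1=x_2 is a double root, g'(x_1)=0 and the formula divides by zero. All other claims hold for all c>0, d≥0. *)

theory Defs
  imports "HOL-Probability.Probability" "Jordan_Normal_Form.Determinant"
begin

section \<open>Weighted spanning trees of finite simple graphs\<close>

text \<open>
  A simple graph is a vertex set \<open>V\<close> together with a set \<open>E\<close> of two-element subsets of \<open>V\<close>;
  a spanning tree is identified with its edge set. As there are no loops or parallel edges,
  cycles have length at least three.
\<close>

definition connects :: "'v set \<Rightarrow> 'v set set \<Rightarrow> bool" where
  "connects V F \<longleftrightarrow> (\<forall>u\<in>V. \<forall>v\<in>V. (u, v) \<in> {(a, b). {a, b} \<in> F}\<^sup>*)"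

definition graph_cycle :: "'v set set \<Rightarrow> 'v list \<Rightarrow> bool" where
  "graph_cycle F vs \<longleftrightarrow> 3 \<le> length vs \<and> distinct vs \<and>
     (\<forall>i<length vs. {vs ! i, vs ! (Suc i mod length vs)} \<in> F)"

definition spanning_trees :: "'v set \<Rightarrow> 'v set set \<Rightarrow> 'v set set set" where
  "spanning_trees V E = {F. F \<subseteq> E \<and> connects V F \<and> (\<nexists>vs. graph_cycle F vs)}"

definition tree_weight :: "('e \<Rightarrow> real) \<Rightarrow> 'e set \<Rightarrow> real" where
  "tree_weight w F = (\<Prod>e\<in>F. w e)"

definition finite_wst_measure ::
    "('v set \<Rightarrow> real) \<Rightarrow> 'v set \<Rightarrow> 'v set set \<Rightarrow> 'v set set measure" where
  "finite_wst_measure w V E =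
     point_measure (spanning_trees V E)
       (\<lambda>F. ennreal (tree_weight w F / (\<Sum>F'\<in>spanning_trees V E. tree_weight w F')))"


section \<open>The enhanced helix-3-graph\<close>

definition z_edge :: "int \<Rightarrow> int set" where "z_edge m = {m - 1, m}"
definition g_edge :: "int \<Rightarrow> int set" where "g_edge m = {m - 2, m}"
definition h_edge :: "int \<Rightarrow> int set" where "h_edge m = {m - 3, m}"

definition helix_edges :: "int set set" where
  "helix_edges = range z_edge \<union> range g_edge \<union> range h_edge"

definition helix_weight :: "real \<Rightarrow> real \<Rightarrow> int set \<Rightarrow> real" where
  "helix_weight c d e =
     (if e \<in> range z_edge then c else if e \<in> range g_edge then d else 1)"

text \<open>Edge configurations, with the \<open>\<sigma>\<close>-algebra generated by the events that an edge is present.\<close>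

definition edge_configs :: "'e set \<Rightarrow> 'e set measure" where
  "edge_configs E = sigma (Pow E) {{F \<in> Pow E. e \<in> F} | e. e \<in> E}"

definition helix_box_measure :: "real \<Rightarrow> real \<Rightarrow> nat \<Rightarrow> int set set measure" where
  "helix_box_measure c d n =
     (let V = {- int n..int n}
      in finite_wst_measure (helix_weight c d) V {e \<in> helix_edges. e \<subseteq> V})"

text \<open>
  An event depending only on the edges in a finite set \<open>S\<close> has the form \<open>F \<inter> S \<in> C\<close>
  for a family \<open>C\<close> of edge sets.
\<close>

definition helix_wst_measure :: "real \<Rightarrow> real \<Rightarrow> int set set measure \<Rightarrow> bool" where
  "helix_wst_measure c d \<mu> \<longleftrightarrow>
     prob_space \<mu> \<and> sets \<mu> = sets (edge_configs helix_edges) \<and>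
     (\<forall>S C. finite S \<and> S \<subseteq> helix_edges \<longrightarrow>
        (\<lambda>n. measure (helix_box_measure c d n)
               {F \<in> space (helix_box_measure c d n). F \<inter> S \<in> C})
          \<longlonglongrightarrow> measure \<mu> {F \<in> space \<mu>. F \<inter> S \<in> C})"


section \<open>Determinantal processes and Fourier transforms\<close>

text \<open>
  The determinant of the finite submatrix does not depend on the enumeration of the index set;
  the increasing one is used.
\<close>

definition principal_submatrix :: "(int \<Rightarrow> int \<Rightarrow> complex) \<Rightarrow> int set \<Rightarrow> complex mat" where
  "principal_submatrix A S =
     mat (card S) (card S)
       (\<lambda>(i, j). A (sorted_list_of_set S ! i) (sorted_list_of_set S ! j))"

definition determinantal_process ::
    "'a measure \<Rightarrow> (int \<Rightarrow> 'a \<Rightarrow> real) \<Rightarrow> (int \<Rightarrow> int \<Rightarrow> complex) \<Rightarrow> bool" where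
  "determinantal_process M X A \<longleftrightarrow>
     (\<forall>m. X m \<in> borel_measurable M \<and> (\<forall>\<omega>\<in>space M. X m \<omega> \<in> {0, 1})) \<and>
     (\<forall>i j. A j i = cnj (A i j)) \<and>
     (\<forall>S. finite S \<longrightarrow>
        complex_of_real (measure M {\<omega> \<in> space M. \<forall>s\<in>S. X s \<omega> = 1})
          = Determinant.det (principal_submatrix A S))"

text \<open>\<open>f\<close> is the \<open>[0,1]\<close>-valued function on \<open>[0,1]\<close> with Fourier coefficients \<open>fh\<close>.\<close>

definition fourier_transform_of :: "(int \<Rightarrow> complex) \<Rightarrow> (real \<Rightarrow> real) \<Rightarrow> bool" where
  "fourier_transform_of fh f \<longleftrightarrow>
     (\<forall>x\<in>{0..1}. 0 \<le> f x \<and> f x \<le> 1) \<and>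
     (\<forall>k. ((\<lambda>x. complex_of_real (f x) *
               exp (- (2 * complex_of_real pi * \<i> * of_int k * complex_of_real x)))
             has_integral fh k) {0..1})"


section \<open>The explicit expressions\<close>

definition helix_g :: "real \<Rightarrow> real \<Rightarrow> complex poly" where
  "helix_g c d = Polynomial.smult (inverse (complex_of_real c))
     (map_poly complex_of_real [:1, d + 2, c + 2 * d + 3, d + 2, 1:])"

text \<open>
  All square roots are principal values; with this branch both numbers below lie in the open
  unit disc.
\<close>

definition helix_x1 :: "real \<Rightarrow> real \<Rightarrow> complex" where
  "helix_x1 c d =
     (let u = - complex_of_real d - 2 + csqrt (complex_of_real (d\<^sup>2 - 4 * d - 4 * c))
      in u / 4 + csqrt (u\<^sup>2 - 16) / 4)"

definition helix_x2 :: "real \<Rightarrow> real \<Rightarrow> complex" where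
  "helix_x2 c d =
     (let u = - complex_of_real d - 2 - csqrt (complex_of_real (d\<^sup>2 - 4 * d - 4 * c))
      in u / 4 + csqrt (u\<^sup>2 - 16) / 4)"

definition helix_f :: "real \<Rightarrow> real \<Rightarrow> real \<Rightarrow> real" where
  "helix_f c d x = c / ((c + 2 * d + 3) + 2 * (d + 2) * cos (2 * pi * x) + 2 * cos (4 * pi * x))"

end

theory Submission
  imports Defs
begin

text \<open>
  Measure a potential on an integer interval by its increments over the path edges
  \<open>z_edge i\<close>. In these coordinates the weighted Laplacian of the box \<open>{-n..n}\<close> is the matrix
  \<open>edge_form\<close>, the sum over edges \<open>e\<close> of the weight of \<open>e\<close> times the rank one matrix of the indicator
  vector \<open>crossing e\<close> of the increments below \<open>e\<close>, and a path edge contributes to a single diagonal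
  entry.

  The Cauchy--Binet formula (\<open>idx_det_sum_rank_one\<close>) and the unimodularity of the incidence
  matrix of a tree (\<open>gram_det_eq_1\<close>) show that its determinant is the tree sum
  (\<open>weighted_matrix_tree\<close>). Since path edges are unit vectors, deleting them only alters diagonal
  entries, and the probability that a finite set of path edges lies in the random tree is a minor of \<open>c\<close>
  times the inverse Laplacian (\<open>path_edges_probability\<close>).

  In the bulk the Laplacian is the Toeplitz operator \<open>helix_operator\<close>, whose symbol is the
  denominator of \<open>helix_f\<close>: with \<open>z\<close> on the unit circle it is
  \<open>c + d * \<bar>1 + z\<bar>\<^sup>2 + \<bar>1 + z + z\<^sup>2\<bar>\<^sup>2\<close>, one term for each kind of edge. Its inverse is
  convolution with the Fourier coefficients of \<open>helix_f\<close>, divided by \<open>c\<close>. Because the path edges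
  bound the Laplacian of every box from below by \<open>c\<close>, the boundary has no influence in the limit: any
  sequence that tends to zero and solves \<open>helix_operator c d v = \<kappa> * \<delta>\<close>, with \<open>\<delta>\<close> the unit
  mass at zero, is the limit of the rows of \<open>\<kappa>\<close> times
  the inverse box matrices (\<open>helix_box_inverse_limit\<close>). Applied to the Fourier
  coefficients this gives the determinantal formula.

  The same statement shows that such a sequence is unique (\<open>helix_operator_unique\<close>). So the
  explicit formula is obtained without evaluating an integral: the two-sided geometric sequences
  built from the roots \<open>x1\<close>, \<open>x2\<close> decay, and checking the recurrence is algebra with the factorisation
  of \<open>g\<close> into \<open>x\<^sup>2 - s1 * x + 1\<close> and \<open>x\<^sup>2 - s2 * x + 1\<close>.
\<close>

section \<open>Determinants over finite index sets\<close>

text \<open>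
  Determinants of matrices indexed by an arbitrary finite set of labels. The index sets below are
  sets of integers that grow with the box and from which subsets are singled out; for matrices
  indexed by initial segments of the natural numbers every such step would be a renumbering.
\<close>
definition idx_det :: "'i set \<Rightarrow> ('i \<Rightarrow> 'i \<Rightarrow> 'a::comm_ring_1) \<Rightarrow> 'a" where
  "idx_det I A = (\<Sum>p | p permutes I. of_int (sign p) * (\<Prod>j\<in>I. A (p j) j))"

lemma idx_det_cong:
  assumes "\<And>i j. i \<in> I \<Longrightarrow> j \<in> I \<Longrightarrow> A i j = B i j"
  shows "idx_det I A = idx_det I B"
  unfolding idx_det_def
  by (intro sum.cong prod.cong arg_cong2[where f="(*)"] refl)
     (auto simp: assms permutes_in_image)

lemma idx_det_eq_det:
  assumes h: "bij_betw h {0..<n} I"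
  shows "idx_det I A = Determinant.det (mat n n (\<lambda>(i, j). A (h i) (h j)))"
proof -
  define J where "J = {0..<n}"
  have fJ: "finite J" by (simp add: J_def)
  have inj: "inj_on h J" and im: "h ` J = I"
    using h by (auto simp: bij_betw_def J_def)
  have bij: "bij_betw (map_permutation J h) {p. p permutes J} {p. p permutes I}"
  proof (rule bij_betw_byWitness[where f' = "map_permutation I (inv_into J h)"])
    have hJI: "bij_betw h J I" using inj im by (simp add: bij_betw_def)
    have h': "bij_betw (inv_into J h) I J" by (rule bij_betw_inv_into[OF hJI])
    show "\<forall>p\<in>{p. p permutes J}. map_permutation I (inv_into J h) (map_permutation J h p) = p"
      using inj by (auto intro!: map_permutation_compose_inv[OF hJI])
    show "\<forall>p\<in>{p. p permutes I}. map_permutation J h (map_permutation I (inv_into J h) p) = p"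
      by (intro ballI map_permutation_compose_inv[OF h']) (simp_all add: f_inv_into_f im)
    show "map_permutation J h ` {p. p permutes J} \<subseteq> {p. p permutes I}"
      using map_permutation_permutes[OF hJI] by auto
    show "map_permutation I (inv_into J h) ` {p. p permutes I} \<subseteq> {p. p permutes J}"
      using map_permutation_permutes[OF h'] by auto
  qed
  have "idx_det I A =
      (\<Sum>p | p permutes J. of_int (sign (map_permutation J h p)) *
         (\<Prod>j\<in>I. A (map_permutation J h p j) j))"
    unfolding idx_det_def by (rule sum.reindex_bij_betw[OF bij, symmetric])
  also have "\<dots> = (\<Sum>p | p permutes J. of_int (sign p) * (\<Prod>j\<in>J. A (h (p j)) (h j)))"
  proof (rule sum.cong[OF refl])
    fix p assume p: "p \<in> {p. p permutes J}"
    have "(\<Prod>j\<in>I. A (map_permutation J h p j) j) = (\<Prod>j\<in>J. A (h (p j)) (h j))"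
      unfolding im[symmetric]
      by (subst prod.reindex[OF inj]) (auto intro!: prod.cong simp: map_permutation_apply inj)
    with p show "of_int (sign (map_permutation J h p)) * (\<Prod>j\<in>I. A (map_permutation J h p j) j) =
       of_int (sign p) * (\<Prod>j\<in>J. A (h (p j)) (h j))"
      using sign_map_permutation[OF inj _ fJ, of p] by simp
  qed
  also have "\<dots> = Determinant.det (mat n n (\<lambda>(i, j). A (h i) (h j)))"
    by (subst det_col[of _ n])
       (auto simp: J_def permutes_in_image lessThan_atLeast0 intro!: sum.cong prod.cong)
  finally show ?thesis .
qed

lemma finite_set_enumeration:
  assumes "finite I"
  obtains h and n :: nat where "bij_betw h {0..<n} I"
  using ex_bij_betw_nat_finite[OF assms] by blast

lemma idx_det_mult:
  assumes "finite I"
  shows "idx_det I (\<lambda>i j. \<Sum>k\<in>I. A i k * B k j) = idx_det I A * idx_det I B"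
proof -
  obtain h and n :: nat where h: "bij_betw h {0..<n} I" using finite_set_enumeration[OF assms] .
  have "mat n n (\<lambda>(i, j). \<Sum>k\<in>I. A (h i) k * B k (h j)) =
     mat n n (\<lambda>(i, j). A (h i) (h j)) * mat n n (\<lambda>(i, j). B (h i) (h j))"
    by (intro eq_matI) (auto simp: scalar_prod_def sum.reindex_bij_betw[OF h, symmetric])
  then show ?thesis
    unfolding idx_det_eq_det[OF h] by (simp add: det_mult[where n = n])
qed

lemma idx_det_transpose:
  assumes "finite I"
  shows "idx_det I (\<lambda>i j. A j i) = idx_det I A"
proof -
  obtain h and n :: nat where h: "bij_betw h {0..<n} I" using finite_set_enumeration[OF assms] .
  have "mat n n (\<lambda>(i, j). A (h j) (h i)) = transpose_mat (mat n n (\<lambda>(i, j). A (h i) (h j)))"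
    by (intro eq_matI) auto
  then show ?thesis
    unfolding idx_det_eq_det[OF h] by (simp add: det_transpose[where n = n])
qed

lemma idx_det_identical_columns:
  assumes "finite I" "a \<in> I" "b \<in> I" "a \<noteq> b" "\<And>i. i \<in> I \<Longrightarrow> A i a = A i b"
  shows "idx_det I A = 0"
proof -
  obtain h and n :: nat where h: "bij_betw h {0..<n} I" using finite_set_enumeration[OF assms(1)] .
  from h assms obtain k l where kl: "k < n" "l < n" "h k = a" "h l = b"
    by (force simp: bij_betw_def image_iff)
  let ?M = "mat n n (\<lambda>(i, j). A (h i) (h j))"
  have "col ?M k = col ?M l"
    using kl(1,2) bij_betwE[OF h] assms(5)[folded kl(3,4)] by (intro eq_vecI) auto
  moreover have "k \<noteq> l" using kl assms(4) by blast
  ultimately have "Determinant.det ?M = 0"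
    using kl by (intro det_identical_columns[of _ n k l]) auto
  then show ?thesis unfolding idx_det_eq_det[OF h] .
qed

lemma idx_det_eq_0_iff:
  fixes A :: "'i \<Rightarrow> 'i \<Rightarrow> 'a::idom"
  assumes "finite I"
  shows "idx_det I A = 0 \<longleftrightarrow> (\<exists>y. (\<exists>i\<in>I. y i \<noteq> 0) \<and> (\<forall>i\<in>I. (\<Sum>j\<in>I. A i j * y j) = 0))"
    (is "_ \<longleftrightarrow> ?R")
proof -
  obtain h and n :: nat where h: "bij_betw h {0..<n} I" using finite_set_enumeration[OF assms] .
  have im: "I = h ` {0..<n}" using h by (simp add: bij_betw_def)
  let ?M = "mat n n (\<lambda>(i, j). A (h i) (h j))"
  have mv: "?M *\<^sub>v vec n (\<lambda>k. y (h k)) = 0\<^sub>v n \<longleftrightarrow> (\<forall>i\<in>I. (\<Sum>j\<in>I. A i j * y j) = 0)" for y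
  proof -
    have "(\<Sum>k = 0..<n. A (h i) (h k) * y (h k)) = (\<Sum>j\<in>I. A (h i) j * y j)" for i
      by (rule sum.reindex_bij_betw[OF h])
    moreover have "(\<forall>i\<in>I. P i) \<longleftrightarrow> (\<forall>k<n. P (h k))" for P
      by (auto simp: im)
    ultimately show ?thesis by (simp add: vec_eq_iff scalar_prod_def)
  qed
  have nz: "vec n (\<lambda>k. y (h k)) \<noteq> 0\<^sub>v n \<longleftrightarrow> (\<exists>i\<in>I. y i \<noteq> 0)" for y :: "'i \<Rightarrow> 'a"
    by (subst im) (auto simp: vec_eq_iff)
  have "(\<exists>v. v \<in> carrier_vec n \<and> v \<noteq> 0\<^sub>v n \<and> ?M *\<^sub>v v = 0\<^sub>v n) \<longleftrightarrow> ?R"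
  proof
    assume "\<exists>v. v \<in> carrier_vec n \<and> v \<noteq> 0\<^sub>v n \<and> ?M *\<^sub>v v = 0\<^sub>v n"
    then obtain v where v: "v \<in> carrier_vec n" "v \<noteq> 0\<^sub>v n" "?M *\<^sub>v v = 0\<^sub>v n" by blast
    define y where "y i = v $ (inv_into {0..<n} h i)" for i
    have "v = vec n (\<lambda>k. y (h k))"
      using v(1) h by (intro eq_vecI) (auto simp: y_def bij_betw_def inv_into_f_f)
    then show ?R using v mv[of y] nz[of y] by blast
  next
    assume ?R
    then obtain y where "\<exists>i\<in>I. y i \<noteq> 0" "\<forall>i\<in>I. (\<Sum>j\<in>I. A i j * y j) = 0" by blast
    then show "\<exists>v. v \<in> carrier_vec n \<and> v \<noteq> 0\<^sub>v n \<and> ?M *\<^sub>v v = 0\<^sub>v n"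
      using mv[of y] nz[of y] by (intro exI[of _ "vec n (\<lambda>k. y (h k))"]) auto
  qed
  then show ?thesis
    unfolding idx_det_eq_det[OF h] by (subst det_0_iff_vec_prod_zero[of _ n]) auto
qed

lemma idx_det_left_inverse:
  fixes A :: "'i \<Rightarrow> 'i \<Rightarrow> 'a::field"
  assumes "finite I" "idx_det I A \<noteq> 0"
  obtains C where "\<And>i j. i \<in> I \<Longrightarrow> j \<in> I \<Longrightarrow> (\<Sum>k\<in>I. C i k * A k j) = (if i = j then 1 else 0)"
proof -
  obtain h and n :: nat where h: "bij_betw h {0..<n} I" using finite_set_enumeration[OF assms(1)] .
  define g where "g = inv_into {0..<n} h"
  have g: "bij_betw g I {0..<n}" unfolding g_def by (rule bij_betw_inv_into[OF h])
  have hg: "h (g i) = i" if "i \<in> I" for i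
    using h that by (auto simp: g_def bij_betw_def f_inv_into_f)
  let ?M = "mat n n (\<lambda>(i, j). A (h i) (h j))"
  define D where "D = Determinant.det ?M"
  have D: "D \<noteq> 0" using assms(2) by (simp add: D_def idx_det_eq_det[OF h])
  have M: "?M \<in> carrier_mat n n" by simp
  note adj = adj_mat[OF M]
  define C where "C i k = adj_mat ?M $$ (g i, g k) / D" for i k
  show ?thesis
  proof
    fix i j assume ij: "i \<in> I" "j \<in> I"
    then have lt: "g i < n" "g j < n" using bij_betwE[OF g] by auto
    have "(\<Sum>k\<in>I. C i k * A k j) = (\<Sum>k\<in>I. adj_mat ?M $$ (g i, g k) * A (h (g k)) j) / D"
      by (simp add: C_def sum_divide_distrib hg)
    also have "(\<Sum>k\<in>I. adj_mat ?M $$ (g i, g k) * A (h (g k)) j) =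
        (\<Sum>k = 0..<n. adj_mat ?M $$ (g i, k) * A (h k) j)"
      by (rule sum.reindex_bij_betw[OF g])
    also have "\<dots> = (adj_mat ?M * ?M) $$ (g i, g j)"
      using adj(1) lt ij by (simp add: scalar_prod_def hg)
    also have "\<dots> = (if g i = g j then D else 0)"
      unfolding adj(3) using lt by (simp add: D_def)
    also have "g i = g j \<longleftrightarrow> i = j" using ij hg by metis
    finally show "(\<Sum>k\<in>I. C i k * A k j) = (if i = j then 1 else 0)" using D by auto
  qed
qed

lemma idx_det_of_int: "idx_det I (\<lambda>i j. of_int (A i j)) = of_int (idx_det I A)"
  by (simp add: idx_det_def)

lemma idx_det_of_real: "idx_det I (\<lambda>i j. of_real (A i j)) = of_real (idx_det I A)"
  by (simp add: idx_det_def)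

lemma idx_det_delta: "finite I \<Longrightarrow> idx_det I (\<lambda>i j. if i = j then 1 else 0) = (1::'a::comm_ring_1)"
proof -
  assume "finite I"
  then obtain h and n :: nat where h: "bij_betw h {0..<n} I" by (rule finite_set_enumeration)
  have "mat n n (\<lambda>(i, j). if h i = h j then 1 else (0::'a)) = 1\<^sub>m n"
    using h by (intro eq_matI) (auto simp: bij_betw_def inj_on_def)
  then show ?thesis unfolding idx_det_eq_det[OF h] by simp
qed

text \<open>
  Linearity in a column, in the form in which it occurs when an edge is deleted from a graph.
\<close>
lemma idx_det_column_diff:
  assumes "finite I" "m \<in> I"
    and "\<And>i j. i \<in> I \<Longrightarrow> j \<in> I \<Longrightarrow> j \<noteq> m \<Longrightarrow> A i j = C i j"
    and "\<And>i j. i \<in> I \<Longrightarrow> j \<in> I \<Longrightarrow> j \<noteq> m \<Longrightarrow> B i j = C i j"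
    and "\<And>i. i \<in> I \<Longrightarrow> C i m = A i m - B i m"
  shows "idx_det I C = idx_det I A - idx_det I B"
proof -
  have "(\<Prod>j\<in>I. C (p j) j) = (\<Prod>j\<in>I. A (p j) j) - (\<Prod>j\<in>I. B (p j) j)" if p: "p permutes I" for p
  proof -
    have "(\<Prod>j\<in>I-{m}. A (p j) j) = (\<Prod>j\<in>I-{m}. C (p j) j)"
         "(\<Prod>j\<in>I-{m}. B (p j) j) = (\<Prod>j\<in>I-{m}. C (p j) j)"
      using assms p by (auto intro!: prod.cong simp: permutes_in_image)
    then show ?thesis
      using assms p by (simp add: prod.remove[of I m] permutes_in_image left_diff_distrib)
  qed
  then show ?thesis
    by (simp add: idx_det_def sum_subtractf[symmetric] right_diff_distrib[symmetric])
qed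

text \<open>
  A permutation that moves some \<open>j\<close> outside \<open>S\<close> meets an off-diagonal zero of a unit column, so
  only permutations of \<open>S\<close> survive in the Leibniz formula. This is what turns a determinant of
  the size of the whole box into one of the size of the observed set.
\<close>
lemma idx_det_unit_columns:
  assumes "finite I" "S \<subseteq> I"
    and "\<And>i j. i \<in> I \<Longrightarrow> j \<in> I - S \<Longrightarrow> A i j = (if i = j then 1 else 0)"
  shows "idx_det I A = idx_det S A"
  unfolding idx_det_def
proof (rule sum.mono_neutral_cong_right)
  show "finite {p. p permutes I}" by (rule finite_permutations[OF assms(1)])
  show "{p. p permutes S} \<subseteq> {p. p permutes I}" using permutes_subset assms(2) by blast
  show "\<forall>p\<in>{p. p permutes I} - {p. p permutes S}. of_int (sign p) * (\<Prod>j\<in>I. A (p j) j) = 0"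
  proof
    fix p assume p: "p \<in> {p. p permutes I} - {p. p permutes S}"
    then obtain j where j: "j \<in> I - S" "p j \<noteq> j"
      using permutes_superset[of p I S] by auto
    then have "A (p j) j = 0" using p assms(3)[of "p j" j] by (auto simp: permutes_in_image)
    then have "(\<Prod>j\<in>I. A (p j) j) = 0" using j assms(1) by (intro prod_zero) auto
    then show "of_int (sign p) * (\<Prod>j\<in>I. A (p j) j) = 0" by simp
  qed
  fix p assume p: "p \<in> {p. p permutes S}"
  have "(\<Prod>j\<in>I. A (p j) j) = (\<Prod>j\<in>S. A (p j) j)"
  proof (rule prod.mono_neutral_right)
    show "\<forall>j\<in>I - S. A (p j) j = 1"
      using p assms(3) by (auto simp: permutes_not_in)
  qed (use assms in auto)
  then show "of_int (sign p) * (\<Prod>j\<in>I. A (p j) j) = of_int (sign p) * (\<Prod>j\<in>S. A (p j) j)"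
    by simp
qed

lemma tendsto_idx_det:
  fixes A :: "'b \<Rightarrow> 'i \<Rightarrow> 'i \<Rightarrow> real"
  assumes "\<And>i j. i \<in> I \<Longrightarrow> j \<in> I \<Longrightarrow> ((\<lambda>n. A n i j) \<longlongrightarrow> B i j) F"
  shows "((\<lambda>n. idx_det I (A n)) \<longlongrightarrow> idx_det I B) F"
  unfolding idx_det_def
  by (intro tendsto_sum tendsto_mult tendsto_const tendsto_prod assms)
     (auto simp: permutes_in_image)

text \<open>
  The Cauchy--Binet formula in a form that chooses no ordering of the edges. Expanding every
  column gives a sum over maps \<open>\<phi>\<close> from indices to edges; a map that is not injective yields two
  proportional columns and drops out, and grouping the others by their image \<open>F\<close> reassembles
  the same expansion for the edge set \<open>F\<close> with all weights equal to one.
\<close>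
lemma idx_det_sum_rank_one:
  fixes w :: "'e \<Rightarrow> 'a::comm_ring_1" and u v :: "'e \<Rightarrow> 'i \<Rightarrow> 'a"
  assumes I: "finite I" and E: "finite E"
  shows "idx_det I (\<lambda>i j. \<Sum>e\<in>E. w e * (u e i * v e j)) =
    (\<Sum>F | F \<subseteq> E \<and> card F = card I. (\<Prod>e\<in>F. w e) * idx_det I (\<lambda>i j. \<Sum>e\<in>F. u e i * v e j))"
proof -
  define t where "t \<phi> = idx_det I (\<lambda>i j. u (\<phi> j) i * v (\<phi> j) j)" for \<phi> :: "'i \<Rightarrow> 'e"
  have t0: "t \<phi> = 0" if "\<not> inj_on \<phi> I" for \<phi>
  proof -
    have "t \<phi> = idx_det I (\<lambda>i j. u (\<phi> j) i) * (\<Prod>j\<in>I. v (\<phi> j) j)"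
      by (simp add: t_def idx_det_def prod.distrib sum_distrib_right mult.assoc)
    moreover from that obtain a b where "a \<in> I" "b \<in> I" "a \<noteq> b" "\<phi> a = \<phi> b"
      by (auto simp: inj_on_def)
    then have "idx_det I (\<lambda>i j. u (\<phi> j) i) = 0"
      by (intro idx_det_identical_columns[OF I, of a b]) auto
    ultimately show ?thesis by simp
  qed
  have expand: "idx_det I (\<lambda>i j. \<Sum>e\<in>G. w e * (u e i * v e j)) =
      (\<Sum>\<phi> | \<phi> \<in> I \<rightarrow>\<^sub>E G \<and> inj_on \<phi> I. (\<Prod>e\<in>\<phi> ` I. w e) * t \<phi>)" if G: "finite G" for G w
  proof -
    have "idx_det I (\<lambda>i j. \<Sum>e\<in>G. w e * (u e i * v e j)) =
      (\<Sum>p | p permutes I. \<Sum>\<phi>\<in>I \<rightarrow>\<^sub>E G. of_int (sign p) *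
         (\<Prod>j\<in>I. w (\<phi> j) * (u (\<phi> j) (p j) * v (\<phi> j) j)))"
      by (simp add: idx_det_def prod_sum_PiE[OF I G] sum_distrib_left)
    also have "\<dots> = (\<Sum>\<phi>\<in>I \<rightarrow>\<^sub>E G. (\<Prod>j\<in>I. w (\<phi> j)) * t \<phi>)"
      by (subst sum.swap) (simp add: t_def idx_det_def prod.distrib sum_distrib_left ac_simps)
    also have "\<dots> = (\<Sum>\<phi> | \<phi> \<in> I \<rightarrow>\<^sub>E G \<and> inj_on \<phi> I. (\<Prod>e\<in>\<phi> ` I. w e) * t \<phi>)"
    proof (rule sum.mono_neutral_cong_right)
      show "finite (I \<rightarrow>\<^sub>E G)" using I G by (intro finite_PiE) auto
    qed (auto simp: t0 prod.reindex)
    finally show ?thesis .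
  qed
  have fin: "finite (I \<rightarrow>\<^sub>E E)" using I E by (intro finite_PiE) auto
  have "idx_det I (\<lambda>i j. \<Sum>e\<in>E. w e * (u e i * v e j)) =
      (\<Sum>\<phi> | \<phi> \<in> I \<rightarrow>\<^sub>E E \<and> inj_on \<phi> I. (\<Prod>e\<in>\<phi> ` I. w e) * t \<phi>)"
    by (rule expand[OF E])
  also have "\<dots> = (\<Sum>F | F \<subseteq> E \<and> card F = card I.
      \<Sum>\<phi> | \<phi> \<in> {\<phi>. \<phi> \<in> I \<rightarrow>\<^sub>E E \<and> inj_on \<phi> I} \<and> \<phi> ` I = F. (\<Prod>e\<in>\<phi> ` I. w e) * t \<phi>)"
    by (rule sum.group[symmetric])
       (use fin E in \<open>auto simp: card_image\<close>)
  also have "\<dots> = (\<Sum>F | F \<subseteq> E \<and> card F = card I.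
      (\<Prod>e\<in>F. w e) * idx_det I (\<lambda>i j. \<Sum>e\<in>F. u e i * v e j))"
  proof (rule sum.cong[OF refl])
    fix F assume "F \<in> {F. F \<subseteq> E \<and> card F = card I}"
    then have F: "F \<subseteq> E" "card F = card I" "finite F" using E finite_subset by auto
    have eq: "{\<phi>. \<phi> \<in> I \<rightarrow>\<^sub>E F \<and> inj_on \<phi> I} =
        {\<phi> \<in> {\<phi>. \<phi> \<in> I \<rightarrow>\<^sub>E E \<and> inj_on \<phi> I}. \<phi> ` I = F}"
    proof -
      have "\<phi> ` I = F" if "\<phi> \<in> I \<rightarrow>\<^sub>E F" "inj_on \<phi> I" for \<phi>
        by (rule card_subset_eq) (use F that in \<open>auto simp: card_image\<close>)
      with F(1) show ?thesis by (auto simp: PiE_iff)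
    qed
    have "idx_det I (\<lambda>i j. \<Sum>e\<in>F. u e i * v e j) = (\<Sum>\<phi> | \<phi> \<in> I \<rightarrow>\<^sub>E F \<and> inj_on \<phi> I. t \<phi>)"
      using expand[OF F(3), of "\<lambda>_. 1"] by simp
    then show "(\<Sum>\<phi> | \<phi> \<in> {\<phi>. \<phi> \<in> I \<rightarrow>\<^sub>E E \<and> inj_on \<phi> I} \<and> \<phi> ` I = F. (\<Prod>e\<in>\<phi> ` I. w e) * t \<phi>) =
        (\<Prod>e\<in>F. w e) * idx_det I (\<lambda>i j. \<Sum>e\<in>F. u e i * v e j)"
      unfolding eq by (simp add: sum_distrib_left)
  qed
  finally show ?thesis .
qed

section \<open>Spanning trees and determinants in path coordinates\<close>

definition interval_graph :: "int \<Rightarrow> int \<Rightarrow> int set set \<Rightarrow> bool" where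
  "interval_graph a b E \<longleftrightarrow> (\<forall>e\<in>E. \<exists>p q. a \<le> p \<and> p < q \<and> q \<le> b \<and> e = {p, q})"

text \<open>
  A potential on \<open>{a..b}\<close> is determined, up to a constant, by its increments over the path edges
  \<open>{i - 1, i}\<close>, \<open>a < i \<le> b\<close>. In these coordinates the difference of the potential along an
  edge \<open>e\<close> is the sum of the increments at the points \<open>i\<close> that \<open>e\<close> crosses, so \<open>crossing e\<close> is
  the row of the incidence matrix at \<open>e\<close>. These coordinates make the row of a path
  edge a unit vector, and dropping a root vertex is built in.
\<close>
definition crossing :: "int set \<Rightarrow> int \<Rightarrow> int" where
  "crossing e i = (if Min e < i \<and> i \<le> Max e then 1 else 0)"

lemma crossing_pair:
  "p \<le> q \<Longrightarrow> crossing {p, q} i = (if p < i \<and> i \<le> q then 1 else 0)"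
  by (simp add: crossing_def max_def min_def)

lemma interval_graph_subset: "interval_graph a b E \<Longrightarrow> F \<subseteq> E \<Longrightarrow> interval_graph a b F"
  by (auto simp: interval_graph_def)

lemma finite_interval_graph: "interval_graph a b E \<Longrightarrow> finite E"
  by (rule finite_subset[of _ "Pow {a..b}"]) (auto simp: interval_graph_def)

abbreviation adjacent :: "'v set set \<Rightarrow> ('v \<times> 'v) set" where
  "adjacent F \<equiv> {(p, q). {p, q} \<in> F}"

lemma reach_sym: "(p, q) \<in> (adjacent F)\<^sup>* \<Longrightarrow> (q, p) \<in> (adjacent F)\<^sup>*"
  by (rule symD[OF sym_rtrancl]) (auto simp: sym_def insert_commute)

text \<open>
  The increments add up along a walk, with sign \<open>-1\<close> where an edge is traversed downwards. That the
  coefficients are integers is what later forces unimodularity.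
\<close>
lemma reach_combination:
  assumes F: "interval_graph a b F" and "(u, v) \<in> (adjacent F)\<^sup>*"
  shows "\<exists>\<alpha>::int set \<Rightarrow> int. \<forall>i. of_bool (i \<le> v) - of_bool (i \<le> u) = (\<Sum>e\<in>F. \<alpha> e * crossing e i)"
  using assms(2)
proof (induction rule: rtrancl_induct)
  case base
  show ?case by (intro exI[of _ "\<lambda>_. 0"]) simp
next
  case (step y z)
  then obtain \<alpha> :: "int set \<Rightarrow> int"
    where \<alpha>: "\<And>i. of_bool (i \<le> y) - of_bool (i \<le> u) = (\<Sum>e\<in>F. \<alpha> e * crossing e i)" by blast
  define s :: int where "s = (if y < z then 1 else -1)"
  have yz: "{y, z} \<in> F" using step by simp
  have s: "of_bool (i \<le> z) - of_bool (i \<le> y) = s * crossing {y, z} i" for i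
    using crossing_pair[of y z i] crossing_pair[of z y i]
    by (cases "y < z") (auto simp: s_def insert_commute)
  have "of_bool (i \<le> z) - of_bool (i \<le> u) =
      (\<Sum>e\<in>F. (\<alpha> e + (if e = {y, z} then s else 0)) * crossing e i)" for i
  proof -
    have "(\<Sum>e\<in>F. (\<alpha> e + (if e = {y, z} then s else 0)) * crossing e i) =
        (\<Sum>e\<in>F. \<alpha> e * crossing e i) + (\<Sum>e\<in>F. if e = {y, z} then s * crossing e i else 0)"
      by (simp add: distrib_right sum.distrib[symmetric] if_distrib[where f = "\<lambda>x. x * _"] cong: if_cong)
    also have "(\<Sum>e\<in>F. if e = {y, z} then s * crossing e i else 0) = s * crossing {y, z} i"
      using yz finite_interval_graph[OF F] by (simp add: sum.delta)
    finally show ?thesis using \<alpha>[of i] s[of i] by simp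
  qed
  then show ?case by (intro exI[of _ "\<lambda>e. \<alpha> e + (if e = {y, z} then s else 0)"]) blast
qed

text \<open>
  For \<open>F\<close> of the size of a spanning tree, this is by Cauchy--Binet the coefficient of the product
  of the weights of \<open>F\<close> in the determinant of the weighted Laplacian.
\<close>
definition gram_det :: "int \<Rightarrow> int \<Rightarrow> int set set \<Rightarrow> int" where
  "gram_det a b F = idx_det {a<..b} (\<lambda>i j. \<Sum>e\<in>F. crossing e i * crossing e j)"

lemma connects_path_edge:
  assumes F: "interval_graph a b F" "connects {a..b} F" and m: "m \<in> {a<..b}"
  shows "\<exists>\<alpha>. \<forall>i. (\<Sum>e\<in>F. \<alpha> e * crossing e i) = (if i = m then 1 else 0)"
proof -
  have "(m - 1, m) \<in> (adjacent F)\<^sup>*" using F(2) m by (auto simp: connects_def)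
  from reach_combination[OF F(1) this] obtain \<alpha> :: "int set \<Rightarrow> int" where
    \<alpha>: "\<And>i. of_bool (i \<le> m) - of_bool (i \<le> m - 1) = (\<Sum>e\<in>F. \<alpha> e * crossing e i)" by blast
  show ?thesis by (intro exI[of _ \<alpha>] allI, subst \<alpha>[symmetric]) auto
qed

text \<open>
  The kernel of a Gram matrix is the common kernel of the rows \<open>crossing e\<close>. If \<open>v\<close> cannot be
  reached from \<open>u\<close>, the increments of the indicator function of the component of \<open>u\<close> lie in this
  kernel; if \<open>F\<close> connects all vertices, every unit vector is a combination of the rows, and the
  kernel is trivial.
\<close>
lemma gram_det_nonzero_iff_connects:
  assumes F: "interval_graph a b F"
  shows "gram_det a b F \<noteq> 0 \<longleftrightarrow> connects {a..b} F"
proof -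
  define I where "I = {a<..b}"
  have fin: "finite I" "finite F" using finite_interval_graph[OF F] by (auto simp: I_def)
  have swap: "(\<Sum>j\<in>I. (\<Sum>e\<in>F. crossing e i * crossing e j) * y j) =
      (\<Sum>e\<in>F. crossing e i * (\<Sum>j\<in>I. crossing e j * y j))" for i and y :: "int \<Rightarrow> int"
    by (simp add: sum_distrib_left sum_distrib_right mult.assoc sum.swap[of _ I F])
  have iff: "gram_det a b F = 0 \<longleftrightarrow>
      (\<exists>y. (\<exists>i\<in>I. y i \<noteq> 0) \<and> (\<forall>e\<in>F. (\<Sum>j\<in>I. crossing e j * y j) = 0))"
    unfolding gram_det_def I_def[symmetric] idx_det_eq_0_iff[OF fin(1)] swap
  proof (intro ex_cong1 conj_cong refl iffI ballI)
    fix y :: "int \<Rightarrow> int" and e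
    assume 0: "\<forall>i\<in>I. (\<Sum>e\<in>F. crossing e i * (\<Sum>j\<in>I. crossing e j * y j)) = 0" and e: "e \<in> F"
    have "(\<Sum>e\<in>F. (\<Sum>j\<in>I. crossing e j * y j)\<^sup>2) =
        (\<Sum>e\<in>F. \<Sum>i\<in>I. y i * (crossing e i * (\<Sum>j\<in>I. crossing e j * y j)))"
      by (simp add: power2_eq_square sum_distrib_right mult_ac)
    also have "\<dots> = (\<Sum>i\<in>I. y i * (\<Sum>e\<in>F. crossing e i * (\<Sum>j\<in>I. crossing e j * y j)))"
      by (subst sum.swap) (simp add: sum_distrib_left)
    also have "\<dots> = 0" using 0 by simp
    finally have "\<forall>e\<in>F. (\<Sum>j\<in>I. crossing e j * y j)\<^sup>2 = 0"
      using fin by (subst (asm) sum_nonneg_eq_0_iff) auto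
    with e show "(\<Sum>j\<in>I. crossing e j * y j) = 0" by simp
  qed simp
  show ?thesis
  proof
    assume nz: "gram_det a b F \<noteq> 0"
    show "connects {a..b} F"
    proof (rule ccontr)
      assume "\<not> connects {a..b} F"
      then obtain u v where uv: "u \<in> {a..b}" "v \<in> {a..b}" "(u, v) \<notin> (adjacent F)\<^sup>*"
        by (auto simp: connects_def)
      \<comment> \<open>indicator function of the component of \<open>u\<close>, as a potential\<close>
      define \<phi> :: "int \<Rightarrow> int" where "\<phi> x = of_bool ((u, x) \<in> (adjacent F)\<^sup>*)" for x
      define y where "y i = \<phi> i - \<phi> (i - 1)" for i
      have tele: "(\<Sum>i\<in>{p<..q}. y i) = \<phi> q - \<phi> p" if "p \<le> q" for p q
        using that
      proof (induction q rule: int_ge_induct)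
        case (step q)
        then have "{p<..q + 1} = insert (q + 1) {p<..q}" by auto
        then show ?case using step by (simp add: y_def)
      qed simp
      have "(\<Sum>j\<in>I. crossing e j * y j) = 0" if eF: "e \<in> F" for e
      proof -
        obtain p q where pq: "a \<le> p" "p < q" "q \<le> b" "e = {p, q}"
          using F eF unfolding interval_graph_def by meson
        have "(\<Sum>j\<in>I. crossing e j * y j) = (\<Sum>j\<in>{p<..q}. y j)"
          using pq by (intro sum.mono_neutral_cong_right) (auto simp: I_def crossing_pair)
        also have "\<dots> = \<phi> q - \<phi> p" using pq by (intro tele) auto
        also have "(u, p) \<in> (adjacent F)\<^sup>* \<longleftrightarrow> (u, q) \<in> (adjacent F)\<^sup>*"
        proof -
          have "(p, q) \<in> adjacent F" "(q, p) \<in> adjacent F" using eF pq by (auto simp: insert_commute)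
          then show ?thesis by (meson rtrancl_into_rtrancl)
        qed
        then have "\<phi> q - \<phi> p = 0" by (simp add: \<phi>_def)
        finally show ?thesis .
      qed
      with nz have y0: "\<forall>i\<in>I. y i = 0" using iff by metis
      have const: "\<phi> x = \<phi> a" if "x \<in> {a..b}" for x
        using tele[of a x] that y0 by (auto simp: I_def)
      have "\<phi> u = \<phi> v" using const[OF uv(1)] const[OF uv(2)] by simp
      then show False using uv by (simp add: \<phi>_def)
    qed
  next
    assume conn: "connects {a..b} F"
    show "gram_det a b F \<noteq> 0"
    proof
      assume "gram_det a b F = 0"
      then obtain y m where y: "m \<in> I" "y m \<noteq> 0" "\<forall>e\<in>F. (\<Sum>j\<in>I. crossing e j * y j) = 0"
        unfolding iff by blast
      obtain \<alpha> where \<alpha>: "\<And>i. (\<Sum>e\<in>F. \<alpha> e * crossing e i) = (if i = m then 1 else 0)"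
        using connects_path_edge[OF F conn, of m] y(1) by (auto simp: I_def)
      have "y m = (\<Sum>i\<in>I. (\<Sum>e\<in>F. \<alpha> e * crossing e i) * y i)"
        using y(1) fin by (simp add: \<alpha> if_distrib[where f = "\<lambda>x. x * _"] cong: if_cong)
      also have "\<dots> = (\<Sum>e\<in>F. \<alpha> e * (\<Sum>i\<in>I. crossing e i * y i))"
        by (simp add: sum_distrib_left sum_distrib_right mult.assoc sum.swap[of _ I F])
      also have "\<dots> = 0" using y(3) by simp
      finally show False using y(2) by simp
    qed
  qed
qed

text \<open>
  For as many edges as indices the Gram matrix is \<open>U\<close> times its transpose, with \<open>U\<close> a square
  integer matrix. Connectedness writes each unit vector as an integer combination of the columns of
  \<open>U\<close>, so \<open>U\<close> has an integer inverse, its determinant is a unit of the integers, and the square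
  of the determinant is one.
\<close>
lemma gram_det_eq_1:
  assumes F: "interval_graph a b F" "connects {a..b} F" and card: "card F = card {a<..b}"
  shows "gram_det a b F = 1"
proof -
  define I where "I = {a<..b}"
  have fin: "finite I" "finite F" using finite_interval_graph[OF F(1)] by (auto simp: I_def)
  obtain h where h: "bij_betw h I F"
    using finite_same_card_bij[of I F] fin card by (auto simp: I_def)
  define U where "U = idx_det I (\<lambda>i j. crossing (h j) i)"
  have "gram_det a b F = idx_det I (\<lambda>i j. \<Sum>k\<in>I. crossing (h k) i * crossing (h k) j)"
    unfolding gram_det_def I_def[symmetric]
    by (intro idx_det_cong sum.reindex_bij_betw[OF h, symmetric])
  also have "\<dots> = U * idx_det I (\<lambda>i j. crossing (h i) j)"
    unfolding U_def by (rule idx_det_mult[OF fin(1)])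
  also have "\<dots> = U * U" unfolding U_def by (subst (2) idx_det_transpose[OF fin(1), symmetric]) simp
  finally have sq: "gram_det a b F = U * U" .
  have "\<forall>m\<in>I. \<exists>\<alpha>. \<forall>i. (\<Sum>e\<in>F. \<alpha> e * crossing e i) = (if i = m then 1 else 0)"
    using connects_path_edge[OF F] by (auto simp: I_def)
  then obtain \<alpha> where \<alpha>: "\<And>m i. m \<in> I \<Longrightarrow> (\<Sum>e\<in>F. \<alpha> m e * crossing e i) = (if i = m then 1 else 0)"
    by metis
  have "1 = idx_det I (\<lambda>i j. if i = j then 1 else (0::int))"
    by (simp add: idx_det_delta fin)
  also have "\<dots> = idx_det I (\<lambda>j i. \<Sum>k\<in>I. crossing (h k) j * \<alpha> i (h k))"
  proof (rule idx_det_cong)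
    fix j i assume "j \<in> I" "i \<in> I"
    then show "(if j = i then 1 else 0) = (\<Sum>k\<in>I. crossing (h k) j * \<alpha> i (h k))"
      using \<alpha>[of i j] by (subst sum.reindex_bij_betw[OF h]) (simp add: mult.commute)
  qed
  also have "\<dots> = U * idx_det I (\<lambda>k i. \<alpha> i (h k))"
    unfolding U_def by (rule idx_det_mult[OF fin(1)])
  finally have "U dvd 1" by (metis dvd_triv_left)
  then have "\<bar>U\<bar> = 1" by simp
  then show ?thesis using sq abs_mult_self_eq[of U] by simp
qed

text \<open>
  Every connected graph contains a connected subgraph with the number of edges of a tree: by
  Cauchy--Binet the nonzero \<open>gram_det a b F\<close> is the sum over subsets of this size, so one of the
  terms is nonzero.
\<close>
lemma connects_subset_of_card:
  assumes F: "interval_graph a b F" "connects {a..b} F"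
  obtains F' where "F' \<subseteq> F" "card F' = card {a<..b}" "connects {a..b} F'"
proof -
  have "gram_det a b F = (\<Sum>F' | F' \<subseteq> F \<and> card F' = card {a<..b}. gram_det a b F')"
    unfolding gram_det_def
    using idx_det_sum_rank_one[of "{a<..b}" F "\<lambda>_. 1" crossing crossing] finite_interval_graph[OF F(1)]
    by simp
  moreover have "gram_det a b F \<noteq> 0" using gram_det_nonzero_iff_connects[OF F(1)] F(2) by blast
  ultimately have "(\<Sum>F' | F' \<subseteq> F \<and> card F' = card {a<..b}. gram_det a b F') \<noteq> 0" by metis
  then obtain F' where "F' \<subseteq> F" "card F' = card {a<..b}" "gram_det a b F' \<noteq> 0"
    by (rule sum.not_neutral_contains_not_neutral) blast
  with that show ?thesis
    using gram_det_nonzero_iff_connects[OF interval_graph_subset[OF F(1)]] by blast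
qed

lemma rtrancl_distinct_path:
  assumes "(p, q) \<in> R\<^sup>*"
  shows "\<exists>vs. vs \<noteq> [] \<and> hd vs = p \<and> last vs = q \<and> distinct vs \<and>
     (\<forall>i. Suc i < length vs \<longrightarrow> (vs ! i, vs ! Suc i) \<in> R)"
  using assms
proof (induction rule: rtrancl_induct)
  case base
  show ?case by (intro exI[of _ "[p]"]) simp
next
  case (step y z)
  then obtain vs where vs: "vs \<noteq> []" "hd vs = p" "last vs = y" "distinct vs"
    "\<And>i. Suc i < length vs \<Longrightarrow> (vs ! i, vs ! Suc i) \<in> R" by blast
  show ?case
  proof (cases "z \<in> set vs")
    case True
    then obtain k where k: "k < length vs" "vs ! k = z" by (auto simp: in_set_conv_nth)
    have "last (take (Suc k) vs) = z" using k by (simp add: take_Suc_conv_app_nth)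
    then show ?thesis using vs
      by (intro exI[of _ "take (Suc k) vs"]) simp
  next
    case False
    have "((vs @ [z]) ! i, (vs @ [z]) ! Suc i) \<in> R" if i: "Suc i < length (vs @ [z])" for i
    proof (cases "Suc i < length vs")
      case True
      then show ?thesis using vs(5) by (simp add: nth_append)
    next
      case False
      with i have i': "Suc i = length vs" by simp
      then have "vs ! i = y" using vs(1,3) by (metis last_conv_nth diff_Suc_1)
      then show ?thesis using i' step.hyps(2) by (simp add: nth_append)
    qed
    then show ?thesis using vs False by (intro exI[of _ "vs @ [z]"]) simp
  qed
qed

text \<open>
  The closing edge of a cycle can be replaced by the rest of the cycle.
\<close>
lemma graph_cycle_reroute:
  assumes "graph_cycle F vs"
  obtains e where "e \<in> F" "\<And>V. connects V F \<Longrightarrow> connects V (F - {e})"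
proof -
  define k where "k = length vs - 1"
  have len: "length vs = Suc k" "2 \<le> k" and dist: "distinct vs"
    and edge: "\<And>i. i < length vs \<Longrightarrow> {vs ! i, vs ! (Suc i mod length vs)} \<in> F"
    using assms by (auto simp: graph_cycle_def k_def)
  define e where "e = {vs ! k, vs ! 0}"
  have e: "e \<in> F" using edge[of k] len by (simp add: e_def)
  have arc: "(vs ! 0, vs ! i) \<in> (adjacent (F - {e}))\<^sup>*" if "i \<le> k" for i
    using that
  proof (induction i)
    case (Suc i)
    have "{vs ! i, vs ! Suc i} \<in> F" using edge[of i] Suc.prems len by simp
    moreover have "{vs ! i, vs ! Suc i} \<noteq> e"
      using dist len Suc.prems unfolding e_def
      by (auto simp: doubleton_eq_iff nth_eq_iff_index_eq)
    ultimately have "(vs ! i, vs ! Suc i) \<in> adjacent (F - {e})" by simp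
    then show ?case using Suc by (meson Suc_leD rtrancl.rtrancl_into_rtrancl)
  qed simp
  have ends: "(vs ! 0, vs ! k) \<in> (adjacent (F - {e}))\<^sup>*" "(vs ! k, vs ! 0) \<in> (adjacent (F - {e}))\<^sup>*"
    using arc[of k] reach_sym[OF arc[of k]] by blast+
  have "adjacent F \<subseteq> (adjacent (F - {e}))\<^sup>*"
    using ends by (auto simp: e_def doubleton_eq_iff)
  then have "(adjacent F)\<^sup>* \<subseteq> (adjacent (F - {e}))\<^sup>*" by (rule rtrancl_subset_rtrancl)
  with e that show ?thesis unfolding connects_def by blast
qed

text \<open>
  Compare \<open>F\<close> with a connected subset \<open>F'\<close> of tree size. If \<open>F\<close> has an edge outside \<open>F'\<close>, this
  edge closes a cycle with a path in \<open>F'\<close>; so acyclicity forces \<open>F = F'\<close>. Conversely, an edge of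
  a cycle could be removed without disconnecting, leaving a connected set with too few edges.
\<close>
lemma mem_spanning_trees_iff:
  assumes E: "interval_graph a b E"
  shows "F \<in> spanning_trees {a..b} E \<longleftrightarrow> F \<subseteq> E \<and> card F = card {a<..b} \<and> connects {a..b} F"
proof (cases "F \<subseteq> E \<and> connects {a..b} F")
  case False
  then show ?thesis by (auto simp: spanning_trees_def)
next
  case True
  then have F: "interval_graph a b F" "connects {a..b} F" "F \<subseteq> E"
    using interval_graph_subset[OF E] by auto
  have fin: "finite F" by (rule finite_interval_graph[OF F(1)])
  have "(\<nexists>vs. graph_cycle F vs) \<longleftrightarrow> card F = card {a<..b}"
  proof
    assume acyclic: "\<nexists>vs. graph_cycle F vs"
    obtain F' where F': "F' \<subseteq> F" "card F' = card {a<..b}" "connects {a..b} F'"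
      using connects_subset_of_card[OF F(1,2)] .
    have "F' = F"
    proof (rule ccontr)
      assume "F' \<noteq> F"
      then obtain e where e: "e \<in> F" "e \<notin> F'" using F'(1) by blast
      then obtain p q where "a \<le> p" "p < q" "q \<le> b" "e = {p, q}"
        using F(1) unfolding interval_graph_def by meson
      with e have pq: "a \<le> p" "p < q" "q \<le> b" "{p, q} \<in> F" "{p, q} \<notin> F'" by auto
      then have "(p, q) \<in> (adjacent F')\<^sup>*" using F'(3) by (auto simp: connects_def)
      then obtain vs where vs: "vs \<noteq> []" "hd vs = p" "last vs = q" "distinct vs"
        "\<And>i. Suc i < length vs \<Longrightarrow> {vs ! i, vs ! Suc i} \<in> F'"
        using rtrancl_distinct_path[of p q "adjacent F'"] by auto
      have ends: "vs ! 0 = p" "vs ! (length vs - 1) = q"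
        using vs by (auto simp: hd_conv_nth last_conv_nth)
      \<comment> \<open>a path with two vertices would be the edge \<open>{p, q}\<close>, which is not in \<open>F'\<close>\<close>
      have "length vs \<noteq> 0" "length vs \<noteq> 1" "length vs \<noteq> 2"
        using vs(1) ends pq vs(5)[of 0] by auto
      then have len: "3 \<le> length vs" by linarith
      have "{vs ! i, vs ! (Suc i mod length vs)} \<in> F" if "i < length vs" for i
      proof (cases "Suc i < length vs")
        case True
        then show ?thesis using vs(5) F'(1) by auto
      next
        case False
        then have "i = length vs - 1" "Suc i = length vs" using that by auto
        then show ?thesis using ends pq by (simp add: insert_commute)
      qed
      then have "graph_cycle F vs" using len vs(4) by (simp add: graph_cycle_def)
      with acyclic show False by blast
    qed
    then show "card F = card {a<..b}" using F'(2) by simp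
  next
    assume card: "card F = card {a<..b}"
    show "\<nexists>vs. graph_cycle F vs"
    proof
      assume "\<exists>vs. graph_cycle F vs"
      then obtain e where e: "e \<in> F" "connects {a..b} (F - {e})"
        using graph_cycle_reroute F(2) by metis
      then obtain F' where F': "F' \<subseteq> F - {e}" "card F' = card {a<..b}"
        using connects_subset_of_card interval_graph_subset[OF F(1)] by (metis Diff_subset)
      have "card F' \<le> card (F - {e})" using F'(1) fin by (intro card_mono) auto
      then show False using e(1) fin F'(2) card card_Diff1_less[of F e] by simp
    qed
  qed
  with True show ?thesis by (auto simp: spanning_trees_def)
qed

lemma finite_spanning_trees: "interval_graph a b E \<Longrightarrow> finite (spanning_trees V E)"
  by (rule finite_subset[of _ "Pow E"]) (auto simp: spanning_trees_def finite_interval_graph)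

section \<open>The matrix-tree theorem and the transfer current theorem for path edges\<close>

text \<open>
  The weighted graph Laplacian, written in the coordinates of path increments.
\<close>
definition edge_form :: "(int set \<Rightarrow> real) \<Rightarrow> int set set \<Rightarrow> int \<Rightarrow> int \<Rightarrow> real" where
  "edge_form w E i j = (\<Sum>e\<in>E. w e * (crossing e i * crossing e j))"

lemma weighted_matrix_tree:
  assumes E: "interval_graph a b E"
  shows "idx_det {a<..b} (edge_form w E) = (\<Sum>F\<in>spanning_trees {a..b} E. tree_weight w F)"
proof -
  have fin: "finite E" by (rule finite_interval_graph[OF E])
  have "idx_det {a<..b} (edge_form w E) =
     (\<Sum>F | F \<subseteq> E \<and> card F = card {a<..b}. tree_weight w F * real_of_int (gram_det a b F))"
    using idx_det_sum_rank_one[of "{a<..b}" E w "\<lambda>e i. real_of_int (crossing e i)"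
        "\<lambda>e i. real_of_int (crossing e i)"] fin
    unfolding edge_form_def gram_det_def idx_det_of_int[symmetric] tree_weight_def by simp
  also have "\<dots> = (\<Sum>F\<in>spanning_trees {a..b} E. tree_weight w F)"
  proof (rule sum.mono_neutral_cong_right)
    show "finite {F. F \<subseteq> E \<and> card F = card {a<..b}}" using fin by simp
    show "spanning_trees {a..b} E \<subseteq> {F. F \<subseteq> E \<and> card F = card {a<..b}}"
      using mem_spanning_trees_iff[OF E] by auto
    show "\<forall>F\<in>{F. F \<subseteq> E \<and> card F = card {a<..b}} - spanning_trees {a..b} E.
        tree_weight w F * real_of_int (gram_det a b F) = 0"
      using mem_spanning_trees_iff[OF E] interval_graph_subset[OF E] gram_det_nonzero_iff_connects
      by auto
    show "tree_weight w F * real_of_int (gram_det a b F) = tree_weight w F"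
      if "F \<in> spanning_trees {a..b} E" for F
      using that mem_spanning_trees_iff[OF E] interval_graph_subset[OF E] gram_det_eq_1 by auto
  qed
  finally show ?thesis .
qed

text \<open>
  Setting the weight of an edge to zero deletes the trees that use it, so the trees that use \<open>z_edge m\<close> are
  the difference of two tree sums. On the determinant side the change of this weight affects a
  single diagonal entry, because \<open>crossing (z_edge m)\<close> is a unit vector, and the difference
  replaces column \<open>m\<close> by a multiple of that unit vector. Induction on \<open>S\<close> treats the edges one by
  one; the weights are generalised since the deleted graph enters the induction.
\<close>
lemma trees_through_path_edges:
  assumes E: "interval_graph a b E" and S: "finite S" "S \<subseteq> {a<..b}" "z_edge ` S \<subseteq> E"
  shows "(\<Sum>F | F \<in> spanning_trees {a..b} E \<and> z_edge ` S \<subseteq> F. tree_weight w F) =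
    idx_det {a<..b} (\<lambda>i j. if j \<in> S then (if i = j then w (z_edge j) else 0) else edge_form w E i j)"
  using S
proof (induction S arbitrary: w rule: finite_induct)
  case empty
  then show ?case using weighted_matrix_tree[OF E, of w] by simp
next
  case (insert m S)
  define w' where "w' = w(z_edge m := 0)"
  let ?T = "\<lambda>S. {F \<in> spanning_trees {a..b} E. z_edge ` S \<subseteq> F}"
  let ?M = "\<lambda>S w i j. if j \<in> S then (if i = j then w (z_edge j) else 0) else edge_form w E i j"
  have finE: "finite E" by (rule finite_interval_graph[OF E])
  have finT: "finite (spanning_trees {a..b} E)" by (rule finite_spanning_trees[OF E])
  have w': "w' (z_edge j) = (if j = m then 0 else w (z_edge j))" for j
    by (auto simp: w'_def z_edge_def doubleton_eq_iff)
  have cross: "crossing (z_edge m) i = (if i = m then 1 else 0)" for i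
    by (auto simp: z_edge_def crossing_pair)
  have form: "edge_form w' E i j = edge_form w E i j - (if i = m \<and> j = m then w (z_edge m) else 0)" for i j
  proof -
    have "edge_form w E i j - edge_form w' E i j =
        (\<Sum>e\<in>E. if e = z_edge m then w e * (crossing e i * crossing e j) else 0)"
      unfolding edge_form_def sum_subtractf[symmetric] by (rule sum.cong) (auto simp: w'_def)
    also have "\<dots> = (if i = m \<and> j = m then w (z_edge m) else 0)"
      using insert.prems finE by (simp add: cross)
    finally show ?thesis by simp
  qed
  have tw: "tree_weight w' F = (if z_edge m \<in> F then 0 else tree_weight w F)" if "F \<subseteq> E" for F
    using finite_subset[OF that finE] by (auto simp: tree_weight_def w'_def intro!: prod.cong prod_zero)
  have "(\<Sum>F\<in>?T S. tree_weight w' F) = (\<Sum>F\<in>?T S. tree_weight w F) - (\<Sum>F\<in>?T (insert m S). tree_weight w F)"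
  proof -
    have "?T (insert m S) = {F \<in> ?T S. z_edge m \<in> F}" by auto
    moreover have "finite (?T S)" using finT by simp
    ultimately have "(\<Sum>F\<in>?T (insert m S). tree_weight w F) =
       (\<Sum>F\<in>?T S. if z_edge m \<in> F then tree_weight w F else 0)"
      by (simp only: sum.inter_filter)
    moreover have "(\<Sum>F\<in>?T S. tree_weight w' F) = (\<Sum>F\<in>?T S. if z_edge m \<in> F then 0 else tree_weight w F)"
      by (intro sum.cong refl) (auto simp: tw spanning_trees_def)
    ultimately show ?thesis
      by (simp add: sum_subtractf[symmetric]) (intro sum.cong, auto)
  qed
  then have "(\<Sum>F\<in>?T (insert m S). tree_weight w F) =
      idx_det {a<..b} (?M S w) - idx_det {a<..b} (?M S w')"
    using insert.IH[of w] insert.IH[of w'] insert.prems by simp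
  also have "\<dots> = idx_det {a<..b} (?M (insert m S) w)"
    using insert.hyps insert.prems
    by (intro idx_det_column_diff[symmetric, of _ m]) (auto simp: form w')
  finally show ?case .
qed

text \<open>
  The transfer current theorem for path edges. Multiplying the matrix of
  \<open>trees_through_path_edges\<close> from the left by the inverse \<open>C\<close> of the Laplacian turns its columns
  outside \<open>S\<close> into unit vectors, and those in \<open>S\<close> into multiples of columns of \<open>C\<close>.
\<close>
lemma path_edges_probability:
  assumes E: "interval_graph a b E" and S: "finite S" "S \<subseteq> {a<..b}" "z_edge ` S \<subseteq> E"
    and C: "\<And>i j. i \<in> {a<..b} \<Longrightarrow> j \<in> {a<..b} \<Longrightarrow>
      (\<Sum>k\<in>{a<..b}. C i k * edge_form w E k j) = (if i = j then 1 else 0)"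
  shows "(\<Sum>F | F \<in> spanning_trees {a..b} E \<and> z_edge ` S \<subseteq> F. tree_weight w F)
     / (\<Sum>F\<in>spanning_trees {a..b} E. tree_weight w F) = idx_det S (\<lambda>i j. C i j * w (z_edge j))"
proof -
  define I where "I = {a<..b}"
  have fin: "finite I" by (simp add: I_def)
  let ?M = "\<lambda>i j. if j \<in> S then (if i = j then w (z_edge j) else 0) else edge_form w E i j"
  let ?CM = "\<lambda>i j. \<Sum>k\<in>I. C i k * ?M k j"
  have "idx_det I C * idx_det I (edge_form w E) = idx_det I (\<lambda>i j. if i = j then 1 else 0)"
    unfolding idx_det_mult[OF fin, symmetric] by (rule idx_det_cong) (simp add: C I_def)
  then have 1: "idx_det I C * idx_det I (edge_form w E) = 1" by (simp add: idx_det_delta fin)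
  have "idx_det I C * idx_det I ?M = idx_det I ?CM"
    by (rule idx_det_mult[OF fin, symmetric])
  also have "\<dots> = idx_det S ?CM"
    using S C by (intro idx_det_unit_columns[OF fin]) (auto simp: I_def)
  also have "\<dots> = idx_det S (\<lambda>i j. C i j * w (z_edge j))"
  proof (rule idx_det_cong)
    fix i j assume "i \<in> S" "j \<in> S"
    then show "?CM i j = C i j * w (z_edge j)"
      using S(2) fin by (auto simp: I_def if_distrib[where f = "\<lambda>x. _ * x"] cong: if_cong)
  qed
  finally have 2: "idx_det I C * idx_det I ?M = idx_det S (\<lambda>i j. C i j * w (z_edge j))" .
  have nz: "idx_det I (edge_form w E) \<noteq> 0" using 1 by auto
  have "idx_det I ?M / idx_det I (edge_form w E) =
      (idx_det I C * idx_det I (edge_form w E)) * idx_det I ?M / idx_det I (edge_form w E)"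
    unfolding 1 by simp
  also have "\<dots> = idx_det S (\<lambda>i j. C i j * w (z_edge j))"
    using nz 2 by simp
  finally show ?thesis
    unfolding trees_through_path_edges[OF E S] weighted_matrix_tree[OF E, symmetric] I_def .
qed

section \<open>Helix boxes and their limit\<close>

lemma edge_form_mult:
  fixes y :: "int \<Rightarrow> real" and w :: "int set \<Rightarrow> real"
  shows "(\<Sum>l\<in>I. y l * edge_form w E l j) = (\<Sum>e\<in>E. w e * crossing e j * (\<Sum>l\<in>I. crossing e l * y l))"
  by (simp add: edge_form_def sum_distrib_left sum.swap[of _ I E] mult_ac)

text \<open>
  The Dirichlet energy of the potential with increments \<open>y\<close>.
\<close>
lemma edge_form_energy:
  fixes y :: "int \<Rightarrow> real"
  shows "(\<Sum>j\<in>I. (\<Sum>l\<in>I. y l * edge_form w E l j) * y j) = (\<Sum>e\<in>E. w e * (\<Sum>l\<in>I. crossing e l * y l)\<^sup>2)"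
proof -
  have "(\<Sum>j\<in>I. (\<Sum>l\<in>I. y l * edge_form w E l j) * y j) =
      (\<Sum>e\<in>E. \<Sum>j\<in>I. w e * crossing e j * (\<Sum>l\<in>I. crossing e l * y l) * y j)"
    by (simp only: edge_form_mult) (simp only: sum_distrib_right[of _ E], rule sum.swap)
  also have "\<dots> = (\<Sum>e\<in>E. w e * (\<Sum>l\<in>I. crossing e l * y l)\<^sup>2)"
  proof (rule sum.cong[OF refl])
    fix e
    have "(\<Sum>j\<in>I. w e * crossing e j * (\<Sum>l\<in>I. crossing e l * y l) * y j) =
        (\<Sum>j\<in>I. (w e * (\<Sum>l\<in>I. crossing e l * y l)) * (crossing e j * y j))"
      by (intro sum.cong) (simp_all add: mult_ac)
    then show "(\<Sum>j\<in>I. w e * crossing e j * (\<Sum>l\<in>I. crossing e l * y l) * y j) =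
        w e * (\<Sum>l\<in>I. crossing e l * y l)\<^sup>2"
      by (simp add: sum_distrib_left[symmetric] power2_eq_square)
  qed
  finally show ?thesis .
qed

lemma crossing_helix:
  "crossing (z_edge m) i = (if i = m then 1 else 0)"
  "crossing (g_edge m) i = (if i = m - 1 \<or> i = m then 1 else 0)"
  "crossing (h_edge m) i = (if i = m - 2 \<or> i = m - 1 \<or> i = m then 1 else 0)"
  by (auto simp: z_edge_def g_edge_def h_edge_def crossing_pair)

lemma helix_weight_edge:
  "helix_weight c d (z_edge m) = c" "helix_weight c d (g_edge m) = d" "helix_weight c d (h_edge m) = 1"
  by (auto simp: helix_weight_def z_edge_def g_edge_def h_edge_def doubleton_eq_iff)

definition helix_box :: "int \<Rightarrow> int \<Rightarrow> int set set" where
  "helix_box a b = {e \<in> helix_edges. e \<subseteq> {a..b}}"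

lemma interval_graph_helix_box: "interval_graph a b (helix_box a b)"
  unfolding interval_graph_def
proof
  fix e assume "e \<in> helix_box a b"
  then obtain m where "e \<subseteq> {a..b}" "e = {m - 1, m} \<or> e = {m - 2, m} \<or> e = {m - 3, m}"
    by (auto simp: helix_box_def helix_edges_def z_edge_def g_edge_def h_edge_def)
  then show "\<exists>p q. a \<le> p \<and> p < q \<and> q \<le> b \<and> e = {p, q}"
    by (elim disjE) (rule exI[of _ "m - 1"] exI[of _ "m - 2"] exI[of _ "m - 3"], rule exI[of _ m], simp)+
qed

lemma sum_helix_box:
  fixes f :: "int set \<Rightarrow> real"
  shows "(\<Sum>e\<in>helix_box a b. f e) =
    (\<Sum>m\<in>{a<..b}. f (z_edge m)) + (\<Sum>m\<in>{a+1<..b}. f (g_edge m)) + (\<Sum>m\<in>{a+2<..b}. f (h_edge m))"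
proof -
  have box: "helix_box a b = z_edge ` {a<..b} \<union> g_edge ` {a+1<..b} \<union> h_edge ` {a+2<..b}"
    unfolding helix_box_def helix_edges_def
    by (fastforce simp: z_edge_def g_edge_def h_edge_def image_iff)
  have disj: "z_edge ` A \<inter> g_edge ` B = {}" "(z_edge ` A \<union> g_edge ` B) \<inter> h_edge ` C = {}" for A B C
    by (auto simp: z_edge_def g_edge_def h_edge_def doubleton_eq_iff)
  have inj: "inj_on z_edge A" "inj_on g_edge A" "inj_on h_edge A" for A
    by (auto simp: inj_on_def z_edge_def g_edge_def h_edge_def doubleton_eq_iff)
  show ?thesis
    unfolding box by (simp add: sum.union_disjoint disj sum.reindex inj)
qed

text \<open>
  The path edges alone contribute \<open>c\<close> times the squared norm of the increments. The bound
  is uniform in the box, so it controls all inverses in the passage to the limit.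
\<close>
lemma helix_box_coercive:
  fixes y :: "int \<Rightarrow> real"
  assumes "0 < c" "0 \<le> d"
  shows "c * (\<Sum>j\<in>{a<..b}. (y j)\<^sup>2) \<le>
    (\<Sum>j\<in>{a<..b}. (\<Sum>l\<in>{a<..b}. y l * edge_form (helix_weight c d) (helix_box a b) l j) * y j)"
proof -
  define Y where "Y e = (\<Sum>l\<in>{a<..b}. crossing e l * y l)" for e
  have Yz: "Y (z_edge m) = y m" if "m \<in> {a<..b}" for m
    using that by (simp add: Y_def crossing_helix if_distrib[where f = real_of_int]
        if_distrib[where f = "\<lambda>x. x * _"] cong: if_cong)
  have "c * (\<Sum>j\<in>{a<..b}. (y j)\<^sup>2) = (\<Sum>m\<in>{a<..b}. helix_weight c d (z_edge m) * (Y (z_edge m))\<^sup>2)"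
    by (simp add: sum_distrib_left helix_weight_edge Yz)
  also have "\<dots> \<le> (\<Sum>e\<in>helix_box a b. helix_weight c d e * (Y e)\<^sup>2)"
    unfolding sum_helix_box using assms(2)
    by (simp add: helix_weight_edge sum_nonneg)
  finally show ?thesis unfolding edge_form_energy Y_def .
qed

lemma helix_box_left_inverse:
  assumes "0 < c" "0 \<le> d"
  obtains C where "\<And>i j. i \<in> {a<..b} \<Longrightarrow> j \<in> {a<..b} \<Longrightarrow>
    (\<Sum>k\<in>{a<..b}. C i k * edge_form (helix_weight c d) (helix_box a b) k j) = (if i = j then 1 else 0)"
proof -
  define I where "I = {a<..b}"
  have fin: "finite I" by (simp add: I_def)
  let ?B = "edge_form (helix_weight c d) (helix_box a b)"
  have sym: "?B l j = ?B j l" for l j by (simp add: edge_form_def mult_ac)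
  have "idx_det I ?B \<noteq> 0"
    unfolding idx_det_eq_0_iff[OF fin]
  proof (intro notI, elim exE conjE bexE)
    fix y i assume y: "i \<in> I" "y i \<noteq> 0" "\<forall>i\<in>I. (\<Sum>j\<in>I. ?B i j * y j) = 0"
    have "(\<Sum>j\<in>I. (\<Sum>l\<in>I. y l * ?B l j) * y j) = 0"
      using y(3) by (simp add: mult.commute sym)
    then have "(\<Sum>j\<in>I. (y j)\<^sup>2) \<le> 0"
      using helix_box_coercive[OF assms, where a = a and b = b and y = y] assms(1) by (simp add: I_def mult_le_0_iff)
    moreover have "(y i)\<^sup>2 \<le> (\<Sum>j\<in>I. (y j)\<^sup>2)"
      using fin y(1) by (intro member_le_sum) auto
    ultimately show False using y(2) by (smt (verit) zero_less_power2)
  qed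
  from idx_det_left_inverse[OF fin this] that show ?thesis unfolding I_def by blast
qed

definition vanishes_at_infinity :: "(int \<Rightarrow> real) \<Rightarrow> bool" where
  "vanishes_at_infinity v \<longleftrightarrow> (\<forall>\<epsilon>>0. \<exists>N. \<forall>l. N \<le> \<bar>l\<bar> \<longrightarrow> \<bar>v l\<bar> \<le> \<epsilon>)"

text \<open>
  The Laplacian of the infinite graph in path increments: row \<open>i\<close> collects
  \<open>c * v i\<close> from \<open>z_edge i\<close>, \<open>d * (v (m - 1) + v m)\<close> from the edges \<open>g_edge m\<close> with
  \<open>m = i, i + 1\<close>, and \<open>v (m - 2) + v (m - 1) + v m\<close> from the edges \<open>h_edge m\<close> with
  \<open>m = i, i + 1, i + 2\<close>.
\<close>
definition helix_operator :: "real \<Rightarrow> real \<Rightarrow> (int \<Rightarrow> real) \<Rightarrow> int \<Rightarrow> real" where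
  "helix_operator c d v i =
     v (i - 2) + (d + 2) * v (i - 1) + (c + 2 * d + 3) * v i + (d + 2) * v (i + 1) + v (i + 2)"

text \<open>
  The infinite operator and the Laplacian of the box differ only by the edges that
  leave the box, and these meet only the two outermost indices on either side.
\<close>
lemma helix_box_residual:
  assumes d: "0 \<le> d" and i: "i \<in> {a<..b}" and \<epsilon>: "\<And>l. l \<le> a + 2 \<or> b - 1 \<le> l \<Longrightarrow> \<bar>v l\<bar> \<le> \<epsilon>"
  shows "\<bar>helix_operator c d v i
      - (\<Sum>l\<in>{a<..b}. v l * edge_form (helix_weight c d) (helix_box a b) l i)\<bar>
    \<le> (if i \<in> {a + 1, a + 2, b - 1, b} then (4 * d + 9) * \<epsilon> else 0)"
proof -
  define I where "I = {a<..b}"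
  have sumI: "(\<Sum>l\<in>I. (if l = m then 1 else 0) * y l) = y m" if "m \<in> I" for m and y :: "int \<Rightarrow> real"
    using that by (simp add: I_def if_distrib[where f = "\<lambda>x. x * _"] cong: if_cong)
  define Y where "Y e = (\<Sum>l\<in>I. crossing e l * v l)" for e
  have Yz: "Y (z_edge m) = v m" if "m \<in> {a<..b}" for m
  proof -
    have "Y (z_edge m) = (\<Sum>l\<in>I. (if l = m then 1 else 0) * v l)"
      unfolding Y_def by (intro sum.cong) (auto simp: crossing_helix)
    moreover have "m \<in> I" using that by (simp add: I_def)
    ultimately show ?thesis by (simp add: sumI)
  qed
  have Yg: "Y (g_edge m) = v (m - 1) + v m" if "m \<in> {a+1<..b}" for m
  proof -
    have "Y (g_edge m) = (\<Sum>l\<in>I. (if l = m - 1 then 1 else 0) * v l + (if l = m then 1 else 0) * v l)"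
      unfolding Y_def by (intro sum.cong) (auto simp: crossing_helix)
    moreover have "m - 1 \<in> I" "m \<in> I" using that by (simp_all add: I_def)
    ultimately show ?thesis by (simp only: sum.distrib) (simp add: sumI)
  qed
  have Yh: "Y (h_edge m) = v (m - 2) + v (m - 1) + v m" if "m \<in> {a+2<..b}" for m
  proof -
    have "Y (h_edge m) = (\<Sum>l\<in>I. (if l = m - 2 then 1 else 0) * v l
        + (if l = m - 1 then 1 else 0) * v l + (if l = m then 1 else 0) * v l)"
      unfolding Y_def by (intro sum.cong) (auto simp: crossing_helix)
    moreover have "m - 2 \<in> I" "m - 1 \<in> I" "m \<in> I" using that by (simp_all add: I_def)
    ultimately show ?thesis by (simp only: sum.distrib) (simp add: sumI)
  qed
  define G where "G m = (if m \<in> {a+1<..b} then v (m - 1) + v m else 0)" for m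
  define H where "H m = (if m \<in> {a+2<..b} then v (m - 2) + v (m - 1) + v m else 0)" for m
  have "(\<Sum>l\<in>I. v l * edge_form (helix_weight c d) (helix_box a b) l i) =
      (\<Sum>m\<in>{a<..b}. if i = m then c * v m else 0)
    + (\<Sum>m\<in>{a+1<..b}. if m = i \<or> m = i + 1 then d * G m else 0)
    + (\<Sum>m\<in>{a+2<..b}. if m = i \<or> m = i + 1 \<or> m = i + 2 then H m else 0)"
    unfolding edge_form_mult Y_def[symmetric] sum_helix_box
    by (intro arg_cong2[where f = "(+)"] sum.cong)
       (auto simp: helix_weight_edge crossing_helix Yz Yg Yh G_def H_def)
  also have "(\<Sum>m\<in>{a<..b}. if i = m then c * v m else 0) = c * v i"
    using i by simp
  also have "(\<Sum>m\<in>{a+1<..b}. if m = i \<or> m = i + 1 then d * G m else 0) = d * G i + d * G (i + 1)"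
  proof -
    have "(\<Sum>m\<in>{a+1<..b}. if m = i \<or> m = i + 1 then d * G m else 0) = (\<Sum>m\<in>{i, i + 1}. d * G m)"
      by (rule sum.mono_neutral_cong) (auto simp: G_def)
    then show ?thesis by simp
  qed
  also have "(\<Sum>m\<in>{a+2<..b}. if m = i \<or> m = i + 1 \<or> m = i + 2 then H m else 0) = H i + H (i + 1) + H (i + 2)"
  proof -
    have "(\<Sum>m\<in>{a+2<..b}. if m = i \<or> m = i + 1 \<or> m = i + 2 then H m else 0) = (\<Sum>m\<in>{i, i + 1, i + 2}. H m)"
      by (rule sum.mono_neutral_cong) (auto simp: H_def)
    then show ?thesis by simp
  qed
  finally have form: "(\<Sum>l\<in>I. v l * edge_form (helix_weight c d) (helix_box a b) l i) =
      c * v i + (d * G i + d * G (i + 1)) + (H i + H (i + 1) + H (i + 2))" .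
  define G' where "G' m = v (m - 1) + v m - G m" for m
  define H' where "H' m = v (m - 2) + v (m - 1) + v m - H m" for m
  have diff: "helix_operator c d v i
      - (\<Sum>l\<in>I. v l * edge_form (helix_weight c d) (helix_box a b) l i) =
      d * G' i + d * G' (i + 1) + H' i + H' (i + 1) + H' (i + 2)"
    unfolding form helix_operator_def G'_def H'_def by (simp add: algebra_simps)
  show ?thesis
  proof (cases "i \<in> {a + 1, a + 2, b - 1, b}")
    case False
    with i have "G' m = 0" "H' m = 0" if "i \<le> m" "m \<le> i + 2" for m
      using that by (auto simp: G'_def H'_def G_def H_def)
    then show ?thesis using False unfolding diff[unfolded I_def] by simp
  next
    case True
    have e0: "0 \<le> \<epsilon>" using \<epsilon>[of "a + 2"] by simp
    have G': "\<bar>G' m\<bar> \<le> 2 * \<epsilon>" if "a < m" for m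
    proof (cases "m \<in> {a+1<..b}")
      case False
      with that have "\<bar>v (m - 1)\<bar> \<le> \<epsilon>" "\<bar>v m\<bar> \<le> \<epsilon>" by (auto intro!: \<epsilon>)
      with False show ?thesis by (simp add: G'_def G_def)
    qed (use e0 in \<open>simp add: G'_def G_def\<close>)
    have H': "\<bar>H' m\<bar> \<le> 3 * \<epsilon>" if "a < m" for m
    proof (cases "m \<in> {a+2<..b}")
      case False
      with that have "\<bar>v (m - 2)\<bar> \<le> \<epsilon>" "\<bar>v (m - 1)\<bar> \<le> \<epsilon>" "\<bar>v m\<bar> \<le> \<epsilon>" by (auto intro!: \<epsilon>)
      with False show ?thesis by (simp add: H'_def H_def)
    qed (use e0 in \<open>simp add: H'_def H_def\<close>)
    have G'': "\<bar>d * G' m\<bar> \<le> d * (2 * \<epsilon>)" if "a < m" for m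
      using G'[OF that] d by (simp add: abs_mult mult_left_mono)
    have "a < i" "a < i + 1" "a < i + 2" using i by auto
    then have "\<bar>d * G' i + d * G' (i + 1) + H' i + H' (i + 1) + H' (i + 2)\<bar>
        \<le> d * (2 * \<epsilon>) + d * (2 * \<epsilon>) + 9 * \<epsilon>"
      using G''[of i] G''[of "i + 1"] H'[of i] H'[of "i + 1"] H'[of "i + 2"] by linarith
    with True show ?thesis unfolding diff[unfolded I_def] by (simp add: algebra_simps)
  qed
qed

text \<open>
  The difference \<open>w\<close> of the two solutions has image \<open>r\<close> concentrated at the ends of the box. If \<open>W\<close> is the
  largest absolute value of \<open>w\<close>, coercivity gives
  \<open>c * W\<^sup>2 \<le> (\<Sum>j. r j * w j) \<le> W * (\<Sum>j. \<bar>r j\<bar>)\<close>, hence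
  \<open>W \<le> (\<Sum>j. \<bar>r j\<bar>) / c\<close>, where the sum has at most four terms.
\<close>
lemma helix_box_solution_error:
  assumes c: "0 < c" and d: "0 \<le> d"
    and k: "\<And>j. j \<in> {a<..b} \<Longrightarrow>
      (\<Sum>l\<in>{a<..b}. k l * edge_form (helix_weight c d) (helix_box a b) l j) = helix_operator c d v j"
    and \<epsilon>: "\<And>l. l \<le> a + 2 \<or> b - 1 \<le> l \<Longrightarrow> \<bar>v l\<bar> \<le> \<epsilon>"
    and i: "i \<in> {a<..b}"
  shows "\<bar>v i - k i\<bar> \<le> 4 * (4 * d + 9) * \<epsilon> / c"
proof -
  define I where "I = {a<..b}"
  have fin: "finite I" and ne: "I \<noteq> {}" using i by (auto simp: I_def)
  let ?B = "edge_form (helix_weight c d) (helix_box a b)"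
  define w where "w l = v l - k l" for l
  define r where "r j = (\<Sum>l\<in>I. w l * ?B l j)" for j
  have e0: "0 \<le> \<epsilon>" using \<epsilon>[of "a + 2"] by simp
  define K where "K = (4 * d + 9) * \<epsilon>"
  have K0: "0 \<le> K" using d e0 by (simp add: K_def)
  have r: "\<bar>r j\<bar> \<le> (if j \<in> {a + 1, a + 2, b - 1, b} then K else 0)" if "j \<in> I" for j
  proof -
    have "r j = (\<Sum>l\<in>I. v l * ?B l j) - (\<Sum>l\<in>I. k l * ?B l j)"
      by (simp add: r_def w_def left_diff_distrib sum_subtractf)
    then have "\<bar>r j\<bar> = \<bar>helix_operator c d v j - (\<Sum>l\<in>I. v l * ?B l j)\<bar>"
      using k that by (simp add: I_def abs_minus_commute)
    with helix_box_residual[OF d, of j a b v \<epsilon> c] \<epsilon> that show ?thesis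
      unfolding I_def K_def by simp
  qed
  have R: "(\<Sum>j\<in>I. \<bar>r j\<bar>) \<le> 4 * K"
  proof -
    have "(\<Sum>j\<in>I. \<bar>r j\<bar>) \<le> (\<Sum>j\<in>I. if j \<in> {a + 1, a + 2, b - 1, b} then K else 0)"
      by (intro sum_mono r)
    also have "\<dots> = (\<Sum>j\<in>I \<inter> {a + 1, a + 2, b - 1, b}. K)"
      by (rule sum.inter_restrict[OF fin, symmetric])
    also have "\<dots> \<le> (\<Sum>j\<in>{a + 1, a + 2, b - 1, b}. K)"
      using K0 by (intro sum_mono2) auto
    also have "\<dots> \<le> 4 * K"
      using K0 card_insert_le_m1[of 4] by (auto simp: card_insert_if)
    finally show ?thesis .
  qed
  obtain m where m: "m \<in> I" "\<And>l. l \<in> I \<Longrightarrow> \<bar>w l\<bar> \<le> \<bar>w m\<bar>"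
  proof -
    have "Max ((\<lambda>l. \<bar>w l\<bar>) ` I) \<in> (\<lambda>l. \<bar>w l\<bar>) ` I" using fin ne by (intro Max_in) auto
    then obtain m where "m \<in> I" "Max ((\<lambda>l. \<bar>w l\<bar>) ` I) = \<bar>w m\<bar>" by blast
    moreover have "\<bar>w l\<bar> \<le> Max ((\<lambda>l. \<bar>w l\<bar>) ` I)" if "l \<in> I" for l using fin that by (intro Max_ge) auto
    ultimately show ?thesis using that by metis
  qed
  have "c * \<bar>w m\<bar> * \<bar>w m\<bar> \<le> 4 * K * \<bar>w m\<bar>"
  proof -
    have "(w m)\<^sup>2 \<le> (\<Sum>j\<in>I. (w j)\<^sup>2)" using fin m(1) by (intro member_le_sum) auto
    then have "c * (w m)\<^sup>2 \<le> c * (\<Sum>j\<in>I. (w j)\<^sup>2)" using c by simp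
    also have "\<dots> \<le> (\<Sum>j\<in>I. r j * w j)"
      using helix_box_coercive[OF c d, where a = a and b = b and y = w] by (simp add: I_def r_def)
    also have "\<dots> \<le> (\<Sum>j\<in>I. \<bar>r j\<bar> * \<bar>w m\<bar>)"
    proof (rule sum_mono)
      fix j assume "j \<in> I"
      have "r j * w j \<le> \<bar>r j\<bar> * \<bar>w j\<bar>" by (metis abs_ge_self abs_mult)
      also have "\<dots> \<le> \<bar>r j\<bar> * \<bar>w m\<bar>" using m(2)[OF \<open>j \<in> I\<close>] by (intro mult_left_mono) auto
      finally show "r j * w j \<le> \<bar>r j\<bar> * \<bar>w m\<bar>" .
    qed
    also have "\<dots> = (\<Sum>j\<in>I. \<bar>r j\<bar>) * \<bar>w m\<bar>" by (simp add: sum_distrib_right)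
    also have "\<dots> \<le> 4 * K * \<bar>w m\<bar>" using R by (intro mult_right_mono) auto
    finally show ?thesis by (simp add: power2_eq_square mult.assoc)
  qed
  then have "c * \<bar>w m\<bar> \<le> 4 * K" using K0 by (cases "w m = 0") auto
  then have "\<bar>w m\<bar> \<le> 4 * K / c" using c by (simp add: field_simps)
  moreover have "4 * (4 * d + 9) * \<epsilon> = 4 * K" by (simp add: K_def)
  ultimately show ?thesis using m(2)[of i] i unfolding I_def w_def by simp
qed

text \<open>
  A row of the inverse of the box Laplacian is compared with the translate of \<open>v\<close> that is centred
  at the same index. The value \<open>\<kappa>\<close> is left free, so that the lemma also yields uniqueness for
  the homogeneous equation.
\<close>
lemma helix_box_inverse_limit:
  assumes c: "0 < c" and d: "0 \<le> d"
    and C: "\<And>n i j. i \<in> {- int n<..int n} \<Longrightarrow> j \<in> {- int n<..int n} \<Longrightarrow>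
      (\<Sum>k\<in>{- int n<..int n}. C n i k * edge_form (helix_weight c d) (helix_box (- int n) (int n)) k j)
        = (if i = j then 1 else 0)"
    and v: "vanishes_at_infinity v" "\<And>i. helix_operator c d v i = (if i = 0 then \<kappa> else 0)"
  shows "(\<lambda>n. C n i j * \<kappa>) \<longlonglongrightarrow> v (j - i)"
proof (rule LIMSEQ_I)
  fix r :: real assume r: "0 < r"
  \<comment> \<open>chosen so that the bound of \<open>helix_box_solution_error\<close> becomes \<open>r / 2\<close>\<close>
  define \<epsilon> where "\<epsilon> = r * c / (8 * (4 * d + 9))"
  have \<epsilon>: "0 < \<epsilon>" "4 * (4 * d + 9) * \<epsilon> / c = r / 2"
  proof -
    obtain q where q: "4 * d + 9 = q" by blast
    then have "0 < q" using d by simp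
    then show "0 < \<epsilon>" "4 * (4 * d + 9) * \<epsilon> / c = r / 2"
      using r c unfolding \<epsilon>_def q by simp_all
  qed
  obtain N where N: "\<And>l. N \<le> \<bar>l\<bar> \<Longrightarrow> \<bar>v l\<bar> \<le> \<epsilon>"
    using v(1) \<epsilon>(1) unfolding vanishes_at_infinity_def by blast
  show "\<exists>no. \<forall>n\<ge>no. norm (C n i j * \<kappa> - v (j - i)) < r"
  proof (intro exI allI impI)
    \<comment> \<open>the margin keeps the ends of the box, shifted by \<open>i\<close>, beyond \<open>N\<close>\<close>
    fix n assume n: "nat (\<bar>N\<bar> + \<bar>i\<bar> + \<bar>j\<bar> + 3) \<le> n"
    then have n': "\<bar>N\<bar> + \<bar>i\<bar> + \<bar>j\<bar> + 3 \<le> int n" by linarith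
    have ij: "i \<in> {- int n<..int n}" "j \<in> {- int n<..int n}" using n' by auto
    have "\<bar>v (j - i) - C n i j * \<kappa>\<bar> \<le> 4 * (4 * d + 9) * \<epsilon> / c"
    proof (rule helix_box_solution_error[OF c d, where v = "\<lambda>l. v (l - i)" and k = "\<lambda>l. C n i l * \<kappa>"])
      fix l assume l: "l \<in> {- int n<..int n}"
      have "helix_operator c d (\<lambda>l. v (l - i)) l = helix_operator c d v (l - i)"
        by (simp add: helix_operator_def algebra_simps)
      also have "\<dots> = (if i = l then 1 else 0) * \<kappa>" using v(2) by simp
      also have "\<dots> = (\<Sum>k\<in>{- int n<..int n}.
          C n i k * edge_form (helix_weight c d) (helix_box (- int n) (int n)) k l) * \<kappa>"
        using C[OF ij(1) l] by simp
      finally show "(\<Sum>k\<in>{- int n<..int n}.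
          C n i k * \<kappa> * edge_form (helix_weight c d) (helix_box (- int n) (int n)) k l)
          = helix_operator c d (\<lambda>l. v (l - i)) l"
        by (simp add: sum_distrib_left mult_ac)
    next
      fix l assume "l \<le> - int n + 2 \<or> int n - 1 \<le> l"
      then have "N \<le> \<bar>l - i\<bar>" using n' by arith
      then show "\<bar>v (l - i)\<bar> \<le> \<epsilon>" by (rule N)
    qed (rule ij(2))
    then show "norm (C n i j * \<kappa> - v (j - i)) < r"
      using r unfolding \<epsilon>(2) by (simp add: abs_minus_commute)
  qed
qed

text \<open>
  Both sequences are the limit of the same rows of inverse box matrices.
\<close>
lemma helix_operator_unique:
  assumes cd: "0 < c" "0 \<le> d"
    and v: "vanishes_at_infinity v" "\<And>i. helix_operator c d v i = (if i = 0 then \<kappa> else 0)"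
    and u: "vanishes_at_infinity u" "\<And>i. helix_operator c d u i = (if i = 0 then \<kappa> else 0)"
  shows "u = v"
proof
  fix m
  have "\<exists>C. \<forall>i\<in>{- int n<..int n}. \<forall>j\<in>{- int n<..int n}.
      (\<Sum>k\<in>{- int n<..int n}. C i k * edge_form (helix_weight c d) (helix_box (- int n) (int n)) k j)
        = (if i = j then 1 else 0)" for n
    using helix_box_left_inverse[OF cd] by metis
  then obtain C where C: "\<And>n i j. i \<in> {- int n<..int n} \<Longrightarrow> j \<in> {- int n<..int n} \<Longrightarrow>
      (\<Sum>k\<in>{- int n<..int n}. C n i k * edge_form (helix_weight c d) (helix_box (- int n) (int n)) k j)
        = (if i = j then 1 else 0)" by metis
  have "(\<lambda>n. C n 0 m * \<kappa>) \<longlonglongrightarrow> u (m - 0)" "(\<lambda>n. C n 0 m * \<kappa>) \<longlonglongrightarrow> v (m - 0)"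
    using helix_box_inverse_limit[OF cd C u] helix_box_inverse_limit[OF cd C v] by blast+
  then show "u m = v m" using LIMSEQ_unique by fastforce
qed

lemma helix_box_probability:
  assumes cd: "0 < c" "0 \<le> d" and S: "finite S" "S \<subseteq> {- int n<..int n}"
    and C: "\<And>i j. i \<in> {- int n<..int n} \<Longrightarrow> j \<in> {- int n<..int n} \<Longrightarrow>
      (\<Sum>k\<in>{- int n<..int n}. C i k * edge_form (helix_weight c d) (helix_box (- int n) (int n)) k j)
        = (if i = j then 1 else 0)"
  shows "measure (helix_box_measure c d n)
      {F \<in> space (helix_box_measure c d n). F \<inter> z_edge ` S \<in> {z_edge ` S}} = idx_det S (\<lambda>i j. C i j * c)"
proof -
  define E where "E = helix_box (- int n) (int n)"
  define \<T> where "\<T> = spanning_trees {- int n..int n} E"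
  define w where "w = helix_weight c d"
  define Z where "Z = (\<Sum>F\<in>\<T>. tree_weight w F)"
  have E: "interval_graph (- int n) (int n) E"
    unfolding E_def by (rule interval_graph_helix_box)
  have fin: "finite \<T>" unfolding \<T>_def by (rule finite_spanning_trees[OF E])
  have w0: "0 \<le> tree_weight w F" for F
    unfolding tree_weight_def w_def helix_weight_def using cd by (intro prod_nonneg) auto
  then have Z0: "0 \<le> Z" by (simp add: Z_def sum_nonneg)
  have M: "helix_box_measure c d n = point_measure \<T> (\<lambda>F. ennreal (tree_weight w F / Z))"
    by (simp add: helix_box_measure_def finite_wst_measure_def Let_def \<T>_def E_def helix_box_def Z_def w_def)
  define A where "A = {F \<in> \<T>. z_edge ` S \<subseteq> F}"
  have ev: "{F \<in> space (helix_box_measure c d n). F \<inter> z_edge ` S \<in> {z_edge ` S}} = A"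
    unfolding M space_point_measure A_def by auto
  have SE: "z_edge ` S \<subseteq> E"
    using S(2) by (fastforce simp: E_def helix_box_def helix_edges_def z_edge_def)
  have "emeasure (helix_box_measure c d n) A = (\<Sum>F\<in>A. ennreal (tree_weight w F / Z))"
    unfolding M by (rule emeasure_point_measure_finite[OF fin]) (auto simp: A_def)
  also have "\<dots> = ennreal ((\<Sum>F\<in>A. tree_weight w F) / Z)"
    using w0 Z0 by (simp add: sum_ennreal sum_divide_distrib)
  finally have "measure (helix_box_measure c d n) A = (\<Sum>F\<in>A. tree_weight w F) / Z"
    using w0 Z0 by (simp add: measure_def sum_nonneg)
  also have "\<dots> = idx_det S (\<lambda>i j. C i j * w (z_edge j))"
    unfolding A_def Z_def \<T>_def
    by (rule path_edges_probability[OF E S SE]) (use C in \<open>simp_all add: E_def w_def\<close>)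
  finally show ?thesis unfolding ev by (simp add: w_def helix_weight_edge)
qed

text \<open>
  The box probabilities are determinants of fixed size in the entries of \<open>C\<close>, hence they
  converge with these entries, while by assumption they converge to the probability under \<open>\<mu>\<close>.
\<close>
lemma helix_wst_path_edges:
  assumes cd: "0 < c" "0 \<le> d" and \<mu>: "helix_wst_measure c d \<mu>"
    and v: "vanishes_at_infinity v" "\<And>i. helix_operator c d v i = (if i = 0 then c else 0)"
    and S: "finite S"
  shows "measure \<mu> {F \<in> space \<mu>. z_edge ` S \<subseteq> F} = idx_det S (\<lambda>i j. v (j - i))"
proof -
  have "\<exists>C. \<forall>i\<in>{- int n<..int n}. \<forall>j\<in>{- int n<..int n}.
      (\<Sum>k\<in>{- int n<..int n}. C i k * edge_form (helix_weight c d) (helix_box (- int n) (int n)) k j)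
        = (if i = j then 1 else 0)" for n
    using helix_box_left_inverse[OF cd] by metis
  then obtain C where C: "\<And>n i j. i \<in> {- int n<..int n} \<Longrightarrow> j \<in> {- int n<..int n} \<Longrightarrow>
      (\<Sum>k\<in>{- int n<..int n}. C n i k * edge_form (helix_weight c d) (helix_box (- int n) (int n)) k j)
        = (if i = j then 1 else 0)" by metis
  let ?p = "\<lambda>n. measure (helix_box_measure c d n)
      {F \<in> space (helix_box_measure c d n). F \<inter> z_edge ` S \<in> {z_edge ` S}}"
  have lim: "?p \<longlonglongrightarrow> measure \<mu> {F \<in> space \<mu>. F \<inter> z_edge ` S \<in> {z_edge ` S}}"
    using \<mu> S unfolding helix_wst_measure_def helix_edges_def by blast
  have event: "{F \<in> space \<mu>. F \<inter> z_edge ` S \<in> {z_edge ` S}} = {F \<in> space \<mu>. z_edge ` S \<subseteq> F}"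
    by auto
  have lim': "?p \<longlonglongrightarrow> idx_det S (\<lambda>i j. v (j - i))"
  proof (rule Lim_transform_eventually)
    show "(\<lambda>n. idx_det S (\<lambda>i j. C n i j * c)) \<longlonglongrightarrow> idx_det S (\<lambda>i j. v (j - i))"
      by (intro tendsto_idx_det helix_box_inverse_limit[OF cd C v])
    obtain N where N: "\<And>s. s \<in> S \<Longrightarrow> \<bar>s\<bar> < N"
    proof (rule that)
      fix s assume "s \<in> S"
      then have "\<bar>s\<bar> \<le> Max (abs ` S)" using S by (intro Max_ge) auto
      then show "\<bar>s\<bar> < Max (abs ` S) + 1" by linarith
    qed
    show "\<forall>\<^sub>F n in sequentially. idx_det S (\<lambda>i j. C n i j * c) = ?p n"
      using eventually_ge_at_top[of "nat N"]
    proof eventually_elim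
      case (elim n)
      have "s \<in> {- int n<..int n}" if "s \<in> S" for s
        using N[OF that] elim by auto
      then have "S \<subseteq> {- int n<..int n}" by blast
      from helix_box_probability[OF cd S this C] show ?case by simp
    qed
  qed
  show ?thesis using LIMSEQ_unique[OF lim lim'] unfolding event .
qed

lemma det_principal_submatrix:
  assumes "finite S"
  shows "Determinant.det (principal_submatrix A S) = idx_det S A"
proof -
  have "bij_betw (\<lambda>i. sorted_list_of_set S ! i) {0..<card S} S"
    using bij_betw_nth[of "sorted_list_of_set S" "{0..<card S}" S] assms
    by (simp add: lessThan_atLeast0)
  from idx_det_eq_det[OF this, symmetric] show ?thesis unfolding principal_submatrix_def .
qed

section \<open>Fourier coefficients\<close>

text \<open>
  The Fourier symbol of \<open>helix_operator\<close>.
\<close>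
definition helix_symbol :: "real \<Rightarrow> real \<Rightarrow> real \<Rightarrow> real" where
  "helix_symbol c d x = (c + 2 * d + 3) + 2 * (d + 2) * cos (2 * pi * x) + 2 * cos (4 * pi * x)"

lemma helix_f_eq: "helix_f c d x = c / helix_symbol c d x"
  by (simp add: helix_f_def helix_symbol_def)

text \<open>
  With \<open>y = 2 * cos (2 * pi * x)\<close> the symbol minus \<open>c\<close> is \<open>(y + 1)\<^sup>2 + d * (y + 2)\<close>, and
  \<open>y \<ge> -2\<close>.
\<close>
lemma helix_symbol_ge:
  assumes "0 \<le> d"
  shows "c \<le> helix_symbol c d x"
proof -
  define y where "y = 2 * cos (2 * pi * x)"
  have "-2 \<le> y" using cos_ge_minus_one[of "2 * pi * x"] by (simp add: y_def)
  have "cos (4 * pi * x) = 2 * (cos (2 * pi * x))\<^sup>2 - 1"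
    using cos_double_cos[of "2 * pi * x"] by (simp add: mult.assoc)
  then have "helix_symbol c d x = c + ((y + 1)\<^sup>2 + d * (y + 2))"
    by (simp add: helix_symbol_def y_def power2_eq_square algebra_simps)
  moreover have "0 \<le> d * (y + 2)" using assms \<open>-2 \<le> y\<close> by simp
  ultimately show ?thesis using zero_le_power2[of "y + 1"] by linarith
qed

lemma helix_f_range:
  assumes "0 < c" "0 \<le> d"
  shows "0 \<le> helix_f c d x" "helix_f c d x \<le> 1"
  using helix_symbol_ge[OF assms(2), of c x] assms(1) by (auto simp: helix_f_eq divide_simps)

lemma continuous_on_helix_f:
  assumes "0 < c" "0 \<le> d"
  shows "continuous_on A (helix_f c d)"
proof -
  have "helix_symbol c d x \<noteq> 0" for x using helix_symbol_ge[OF assms(2), of c x] assms(1) by linarith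
  then show ?thesis
    unfolding helix_f_def helix_symbol_def by (intro continuous_intros) auto
qed

text \<open>
  The phase \<open>\<theta>\<close> treats cosine coefficients (\<open>\<theta> = 0\<close>) and sine coefficients
  (\<open>\<theta> = - pi / 2\<close>) at once.
\<close>
definition phased_coefficient :: "real \<Rightarrow> real \<Rightarrow> real \<Rightarrow> int \<Rightarrow> real" where
  "phased_coefficient c d \<theta> m = integral {0..1} (\<lambda>x. helix_f c d x * cos (2 * pi * m * x + \<theta>))"

lemma has_integral_phased:
  assumes "0 < c" "0 \<le> d"
  shows "((\<lambda>x. helix_f c d x * cos (2 * pi * real_of_int m * x + \<theta>)) has_integral
    phased_coefficient c d \<theta> m) {0..1}"
  unfolding phased_coefficient_def
  by (intro integrable_integral integrable_continuous_real continuous_intros continuous_on_helix_f assms)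

lemma has_integral_cos_mode:
  "((\<lambda>x. cos (2 * pi * real_of_int m * x + \<theta>)) has_integral (if m = 0 then cos \<theta> else 0)) {0..1}"
proof (cases "m = 0")
  case True
  then show ?thesis using has_integral_const_real[of "cos \<theta>" 0 1] by simp
next
  case False
  define F where "F x = sin (2 * pi * real_of_int m * x + \<theta>) / (2 * pi * real_of_int m)" for x
  have "(F has_vector_derivative cos (2 * pi * real_of_int m * x + \<theta>)) (at x within {0..1})" for x
    unfolding F_def has_real_derivative_iff_has_vector_derivative[symmetric]
    using False by (auto intro!: derivative_eq_intros)
  then have "((\<lambda>x. cos (2 * pi * real_of_int m * x + \<theta>)) has_integral (F 1 - F 0)) {0..1}"
    by (intro fundamental_theorem_of_calculus) auto
  moreover have "sin (2 * pi * real_of_int m + \<theta>) = sin \<theta>"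
    by (simp add: sin_add sin_integer_2pi cos_integer_2pi)
  then have "F 1 - F 0 = 0" by (simp add: F_def)
  ultimately show ?thesis using False by simp
qed

text \<open>
  Applying the operator to the coefficients multiplies the integrand by the symbol,
  which cancels the denominator of \<open>helix_f\<close> and leaves \<open>c\<close> times a single mode.
\<close>
lemma helix_operator_phased:
  assumes cd: "0 < c" "0 \<le> d"
  shows "helix_operator c d (phased_coefficient c d \<theta>) i = (if i = 0 then c * cos \<theta> else 0)"
proof -
  let ?e = "\<lambda>m x. helix_f c d x * cos (2 * pi * real_of_int m * x + \<theta>)"
  note I = has_integral_phased[OF cd, of _ \<theta>]
  have 1: "((\<lambda>x. ?e (i - 2) x + (d + 2) * ?e (i - 1) x + (c + 2 * d + 3) * ?e i x
        + (d + 2) * ?e (i + 1) x + ?e (i + 2) x) has_integral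
      helix_operator c d (phased_coefficient c d \<theta>) i) {0..1}"
    unfolding helix_operator_def
    by (intro has_integral_add has_integral_mult_right I)
  have "?e (i - 2) x + (d + 2) * ?e (i - 1) x + (c + 2 * d + 3) * ?e i x
        + (d + 2) * ?e (i + 1) x + ?e (i + 2) x = c * cos (2 * pi * real_of_int i * x + \<theta>)" for x
  proof -
    define \<phi> where "\<phi> = 2 * pi * real_of_int i * x + \<theta>"
    define \<xi> where "\<xi> = 2 * pi * x"
    have args: "2 * pi * real_of_int (i - 2) * x + \<theta> = \<phi> - 2 * \<xi>" "2 * pi * real_of_int (i - 1) * x + \<theta> = \<phi> - \<xi>"
      "2 * pi * real_of_int (i + 1) * x + \<theta> = \<phi> + \<xi>" "2 * pi * real_of_int (i + 2) * x + \<theta> = \<phi> + 2 * \<xi>"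
      "2 * pi * real_of_int i * x + \<theta> = \<phi>"
      by (simp_all add: \<phi>_def \<xi>_def algebra_simps)
    have sym: "helix_symbol c d x = (c + 2 * d + 3) + 2 * (d + 2) * cos \<xi> + 2 * cos (2 * \<xi>)"
      by (simp add: helix_symbol_def \<xi>_def mult.assoc)
    have nz: "helix_symbol c d x \<noteq> 0" using helix_symbol_ge[OF cd(2), of c x] cd(1) by linarith
    have "?e (i - 2) x + (d + 2) * ?e (i - 1) x + (c + 2 * d + 3) * ?e i x
        + (d + 2) * ?e (i + 1) x + ?e (i + 2) x =
      helix_f c d x * (helix_symbol c d x * cos \<phi>)"
      unfolding args sym cos_add cos_diff by (simp add: algebra_simps)
    then show ?thesis using nz by (simp add: helix_f_eq \<phi>_def)
  qed
  with 1 have 2: "((\<lambda>x. c * cos (2 * pi * real_of_int i * x + \<theta>)) has_integral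
      helix_operator c d (phased_coefficient c d \<theta>) i) {0..1}" by simp
  have 3: "((\<lambda>x. c * cos (2 * pi * real_of_int i * x + \<theta>)) has_integral
      c * (if i = 0 then cos \<theta> else 0)) {0..1}"
    by (intro has_integral_mult_right has_integral_cos_mode)
  show ?thesis using has_integral_unique[OF 2 3] by simp
qed

text \<open>
  Integration by parts; the boundary terms cancel by periodicity, and the derivative of
  \<open>helix_f\<close> is bounded, which gives decay of order \<open>1 / m\<close>.
\<close>
lemma phased_coefficient_vanishes:
  assumes cd: "0 < c" "0 \<le> d"
  shows "vanishes_at_infinity (phased_coefficient c d \<theta>)"
proof -
  define D where "D = helix_symbol c d"
  have D: "0 < D x" for x using helix_symbol_ge[OF cd(2), of c x] cd(1) by (simp add: D_def)
  define D' where "D' x = - (4 * pi * (d + 2)) * sin (2 * pi * x) - 8 * pi * sin (4 * pi * x)" for x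
  have dD: "(D has_real_derivative D' x) (at x within S)" for x S
    unfolding D_def D'_def helix_symbol_def[abs_def]
    by (auto intro!: derivative_eq_intros simp: algebra_simps)
  define f' where "f' x = - (c * D' x) / (D x)\<^sup>2" for x
  have df: "(helix_f c d has_real_derivative f' x) (at x within S)" for x S
    unfolding helix_f_eq[abs_def] D_def[symmetric] f'_def
    using D[of x] by (auto intro!: derivative_eq_intros dD simp: power2_eq_square)
  have "continuous_on {0..1} D" using dD by (rule DERIV_continuous_on)
  then have "continuous_on {0..1} f'"
    unfolding f'_def D'_def using D by (intro continuous_intros) (auto simp: less_imp_neq[symmetric])
  then have "bounded (f' ` {0..1})" by (intro compact_imp_bounded compact_continuous_image) auto
  then obtain K where "0 < K" and "\<forall>y\<in>f' ` {0..1}. norm y \<le> K" unfolding bounded_pos by blast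
  then have K: "\<bar>f' x\<bar> \<le> K" if "x \<in> {0..1}" for x using that by auto
  have bound: "\<bar>phased_coefficient c d \<theta> m\<bar> \<le> K / \<bar>real_of_int m\<bar>" if m: "m \<noteq> 0" for m
  proof -
    define \<omega> where "\<omega> = 2 * pi * real_of_int m"
    have \<omega>: "\<omega> \<noteq> 0" using m by (simp add: \<omega>_def)
    define F where "F x = helix_f c d x * (sin (\<omega> * x + \<theta>) / \<omega>)" for x
    have "(F has_vector_derivative f' x * (sin (\<omega> * x + \<theta>) / \<omega>) + helix_f c d x * cos (\<omega> * x + \<theta>))
        (at x within {0..1})" for x
      unfolding F_def has_real_derivative_iff_has_vector_derivative[symmetric]
      using \<omega> by (auto intro!: derivative_eq_intros df simp: field_simps)
    then have "((\<lambda>x. f' x * (sin (\<omega> * x + \<theta>) / \<omega>) + helix_f c d x * cos (\<omega> * x + \<theta>))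
        has_integral (F 1 - F 0)) {0..1}"
      by (intro fundamental_theorem_of_calculus) auto
    moreover have "sin (\<omega> + \<theta>) = sin \<theta>"
      by (simp add: \<omega>_def sin_add sin_integer_2pi cos_integer_2pi)
    then have "F 1 - F 0 = 0" by (simp add: F_def helix_f_def)
    ultimately have "((\<lambda>x. f' x * (sin (\<omega> * x + \<theta>) / \<omega>) + helix_f c d x * cos (\<omega> * x + \<theta>))
        has_integral 0) {0..1}" by simp
    from has_integral_diff[OF this has_integral_phased[OF cd, of m \<theta>, folded \<omega>_def]]
    have "((\<lambda>x. (f' x * (sin (\<omega> * x + \<theta>) / \<omega>) + helix_f c d x * cos (\<omega> * x + \<theta>))
        - helix_f c d x * cos (\<omega> * x + \<theta>)) has_integral (0 - phased_coefficient c d \<theta> m)) {0..1}"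
      .
    then have *: "((\<lambda>x. f' x * (sin (\<omega> * x + \<theta>) / \<omega>)) has_integral (- phased_coefficient c d \<theta> m)) {0..1}"
      by simp
    have "norm (- phased_coefficient c d \<theta> m) \<le> (K / \<bar>real_of_int m\<bar>) * measure lborel {0..1::real}"
    proof (rule has_integral_bound_real[OF _ _ *])
      fix x :: real assume "x \<in> {0..1} - {}"
      then have "\<bar>f' x\<bar> \<le> K" using K by simp
      moreover have "\<bar>sin (\<omega> * x + \<theta>) / \<omega>\<bar> \<le> 1 / \<bar>real_of_int m\<bar>"
      proof -
        have "\<bar>real_of_int m\<bar> \<le> \<bar>\<omega>\<bar>"
          using pi_gt3 by (simp add: \<omega>_def abs_mult mult_le_cancel_right1)
        then show ?thesis
          unfolding abs_divide using m by (intro frac_le) auto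
      qed
      ultimately have "\<bar>f' x\<bar> * \<bar>sin (\<omega> * x + \<theta>) / \<omega>\<bar> \<le> K * (1 / \<bar>real_of_int m\<bar>)"
        using \<open>0 < K\<close> by (intro mult_mono) auto
      then show "norm (f' x * (sin (\<omega> * x + \<theta>) / \<omega>)) \<le> K / \<bar>real_of_int m\<bar>"
        by (simp add: abs_mult)
    qed (use \<open>0 < K\<close> in auto)
    then show ?thesis by simp
  qed
  show ?thesis
    unfolding vanishes_at_infinity_def
  proof (intro allI impI)
    fix \<epsilon> :: real assume \<epsilon>: "0 < \<epsilon>"
    show "\<exists>N. \<forall>l. N \<le> \<bar>l\<bar> \<longrightarrow> \<bar>phased_coefficient c d \<theta> l\<bar> \<le> \<epsilon>"
    proof (intro exI[of _ "\<lceil>K / \<epsilon>\<rceil>"] allI impI)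
      fix l :: int assume "\<lceil>K / \<epsilon>\<rceil> \<le> \<bar>l\<bar>"
      then have "K / \<epsilon> \<le> \<bar>real_of_int l\<bar>" by (simp add: ceiling_le_iff)
      moreover have "0 < K / \<epsilon>" using \<open>0 < K\<close> \<epsilon> by simp
      ultimately have l: "0 < \<bar>real_of_int l\<bar>" "K \<le> \<epsilon> * \<bar>real_of_int l\<bar>"
        using \<epsilon> by (linarith, simp add: pos_divide_le_eq mult.commute)
      then have "K / \<bar>real_of_int l\<bar> \<le> \<epsilon>" by (simp add: pos_divide_le_eq)
      then show "\<bar>phased_coefficient c d \<theta> l\<bar> \<le> \<epsilon>" using bound[of l] l(1) by simp
    qed
  qed
qed

definition helix_coefficient :: "real \<Rightarrow> real \<Rightarrow> int \<Rightarrow> real" where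
  "helix_coefficient c d = phased_coefficient c d 0"

lemma helix_coefficient_minus: "helix_coefficient c d (- m) = helix_coefficient c d m"
  by (simp add: helix_coefficient_def phased_coefficient_def)

text \<open>
  The imaginary parts of the Fourier coefficients vanish because the sine coefficients solve the
  homogeneous equation \<open>helix_operator c d v = 0\<close> and tend to zero.
\<close>
lemma fourier_helix:
  assumes cd: "0 < c" "0 \<le> d"
  shows "fourier_transform_of (\<lambda>m. complex_of_real (helix_coefficient c d m)) (helix_f c d)"
  unfolding fourier_transform_of_def
proof (intro conjI ballI allI)
  fix k
  have "helix_operator c d (\<lambda>_. 0) i = 0" for i by (simp add: helix_operator_def)
  then have 0: "phased_coefficient c d (- (pi / 2)) = (\<lambda>_. 0)"
    using helix_operator_phased[OF cd, of "- (pi / 2)"]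
    by (intro helix_operator_unique[OF cd, where \<kappa> = 0] phased_coefficient_vanishes cd)
       (auto simp: vanishes_at_infinity_def)
  have s: "((\<lambda>x. helix_f c d x * sin (2 * pi * real_of_int k * x)) has_integral 0) {0..1}"
    using has_integral_phased[OF cd, of k "- (pi / 2)"] by (simp add: 0 cos_diff)
  have c: "((\<lambda>x. helix_f c d x * cos (2 * pi * real_of_int k * x)) has_integral helix_coefficient c d k) {0..1}"
    using has_integral_phased[OF cd, of k 0] by (simp add: helix_coefficient_def)
  have "((\<lambda>x. complex_of_real (helix_f c d x * cos (2 * pi * real_of_int k * x))
        - \<i> * complex_of_real (helix_f c d x * sin (2 * pi * real_of_int k * x)))
      has_integral (complex_of_real (helix_coefficient c d k) - \<i> * complex_of_real 0)) {0..1}"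
    by (intro has_integral_diff has_integral_mult_right has_integral_of_real s c)
  moreover have "complex_of_real (helix_f c d x * cos (2 * pi * real_of_int k * x))
        - \<i> * complex_of_real (helix_f c d x * sin (2 * pi * real_of_int k * x)) =
      complex_of_real (helix_f c d x) *
        exp (- (2 * complex_of_real pi * \<i> * of_int k * complex_of_real x))" for x
  proof -
    have "exp (- (2 * complex_of_real pi * \<i> * of_int k * complex_of_real x)) =
        exp (\<i> * complex_of_real (- (2 * pi * real_of_int k * x)))"
      by (simp add: mult_ac)
    also have "\<dots> = complex_of_real (cos (2 * pi * real_of_int k * x))
        - \<i> * complex_of_real (sin (2 * pi * real_of_int k * x))"
      by (subst cis_conv_exp[symmetric]) (simp add: complex_eq_iff)
    finally have e: "exp (- (2 * complex_of_real pi * \<i> * of_int k * complex_of_real x)) =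
      complex_of_real (cos (2 * pi * real_of_int k * x)) - \<i> * complex_of_real (sin (2 * pi * real_of_int k * x))" .
    show ?thesis unfolding e by (simp add: algebra_simps)
  qed
  ultimately show "((\<lambda>x. complex_of_real (helix_f c d x) *
        exp (- (2 * complex_of_real pi * \<i> * of_int k * complex_of_real x)))
      has_integral complex_of_real (helix_coefficient c d k)) {0..1}" by simp
qed (use helix_f_range[OF cd] in auto)

section \<open>Roots of the characteristic polynomial\<close>

lemma poly_helix_g:
  "poly (helix_g c d) x =
     (x ^ 4 + (d + 2) * x ^ 3 + (c + 2 * d + 3) * x\<^sup>2 + (d + 2) * x + 1) / c"
  by (simp add: helix_g_def map_poly_pCons divide_inverse algebra_simps eval_nat_numeral)

lemma poly_pderiv_helix_g:
  "poly (pderiv (helix_g c d)) x =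
     (4 * x ^ 3 + 3 * (d + 2) * x\<^sup>2 + 2 * (c + 2 * d + 3) * x + (d + 2)) / c"
  by (simp add: helix_g_def map_poly_pCons pderiv_smult pderiv_pCons divide_inverse algebra_simps eval_nat_numeral)

text \<open>
  In the variable \<open>y = x + 1 / x\<close> the quartic \<open>helix_g c d\<close> becomes this quadratic, up to the factor \<open>x\<^sup>2 / c\<close>. Points \<open>x\<close> of
  the unit circle correspond to \<open>y\<close> in \<open>{-2..2}\<close>, so \<open>helix_g c d\<close> has no root there.
\<close>
lemma helix_resolvent_not_real:
  fixes y :: real
  assumes "0 < c" "0 \<le> d" "-2 \<le> y"
  shows "y\<^sup>2 + (d + 2) * y + (c + 2 * d + 1) \<noteq> 0"
proof -
  have "y\<^sup>2 + (d + 2) * y + (c + 2 * d + 1) = (y + 1)\<^sup>2 + d * (y + 2) + c"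
    by (simp add: power2_eq_square algebra_simps)
  moreover have "0 \<le> d * (y + 2)" using assms by simp
  ultimately show ?thesis using assms(1) zero_le_power2[of "y + 1"] by linarith
qed

text \<open>
  The number \<open>x\<close> solves \<open>x + 1 / x = u / 2\<close>, and with principal roots \<open>x - 1 / x\<close> has
  nonnegative real part. Since \<open>1 / x\<close> has real part \<open>Re x / (norm x)\<^sup>2\<close>, the negative real
  part of \<open>u\<close> gives \<open>Re x < 0\<close>, and then the sign of \<open>Re (x - 1 / x)\<close> gives \<open>norm x \<le> 1\<close>.
  On the unit circle \<open>u / 2 = 2 * Re x\<close> would be a real root of the quadratic in \<open>{-2..2}\<close>.
\<close>
lemma joukowski_root_in_disc:
  fixes c d :: real and u x :: complex
  assumes cd: "0 < c" "0 \<le> d" and u: "Re u < 0"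
    and res: "(u / 2)\<^sup>2 + (d + 2) * (u / 2) + (c + 2 * d + 1) = 0"
    and x: "x = u / 4 + csqrt (u\<^sup>2 - 16) / 4"
  shows "x\<^sup>2 - (u / 2) * x + 1 = 0" "x \<noteq> 0" "x + inverse x = u / 2" "norm x < 1"
proof -
  define q where "q = csqrt (u\<^sup>2 - 16)"
  have q2: "q\<^sup>2 = u\<^sup>2 - 16" by (simp add: q_def)
  have xq: "x = (u + q) / 4" by (simp add: x q_def add_divide_distrib)
  have "x\<^sup>2 - (u / 2) * x + 1 = (q\<^sup>2 - (u\<^sup>2 - 16)) / 16"
    by (simp add: xq power2_eq_square field_simps)
  then show eq: "x\<^sup>2 - (u / 2) * x + 1 = 0" by (simp add: q2)
  then show x0: "x \<noteq> 0" by auto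
  have "x * (x + inverse x) = x * (u / 2)"
    using eq x0 by (simp add: distrib_left power2_eq_square algebra_simps eq_neg_iff_add_eq_0)
  then show sum: "x + inverse x = u / 2" using x0 by (metis mult_cancel_left)
  have dif: "x - inverse x = q / 2"
  proof -
    have "x - inverse x = 2 * x - (x + inverse x)" by simp
    also have "\<dots> = q / 2" unfolding sum by (simp add: xq field_simps)
    finally show ?thesis .
  qed
  define r where "r = (norm x)\<^sup>2"
  have r0: "0 < r" using x0 by (simp add: r_def)
  have Reinv: "Re (inverse x) = Re x / r"
    by (simp add: r_def cmod_power2)
  have "Re x + Re x / r = Re u / 2"
  proof -
    have "Re x + Re x / r = Re (u / 2)"
      using arg_cong[OF sum, of Re] by (simp only: plus_complex.sel Reinv)
    then show ?thesis by simp
  qed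
  moreover have "Re x * (1 + 1 / r) = Re x + Re x / r" by (simp add: distrib_left)
  ultimately have "Re x * (1 + 1 / r) < 0" using u by linarith
  moreover have "0 < 1 + 1 / r" using r0 by (simp add: add_pos_pos)
  ultimately have Rex: "Re x < 0" by (simp add: mult_less_0_iff)
  have "Re x - Re x / r = Re q / 2"
  proof -
    have "Re x - Re x / r = Re (q / 2)"
      using arg_cong[OF dif, of Re] by (simp only: minus_complex.sel Reinv)
    then show ?thesis by simp
  qed
  moreover have "0 \<le> Re q" using csqrt_principal[of "u\<^sup>2 - 16"] by (auto simp: q_def)
  ultimately have "0 \<le> Re x * (1 - 1 / r)" by (simp add: right_diff_distrib)
  then have "1 - 1 / r \<le> 0" using Rex by (simp add: zero_le_mult_iff)
  then have "r \<le> 1" using r0 by (simp add: field_simps)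
  moreover have "r \<noteq> 1"
  proof
    assume r1: "r = 1"
    then have n1: "norm x = 1"
      using power2_eq_imp_eq[of "norm x" 1] by (simp add: r_def)
    have "inverse x = cnj x"
      using n1 x0 by (metis complex_div_cnj div_by_1 inverse_eq_divide mult_1 of_real_1 power_one)
    then have y: "u / 2 = complex_of_real (2 * Re x)"
      using sum by (simp add: complex_eq_iff)
    have "complex_of_real ((2 * Re x)\<^sup>2 + (d + 2) * (2 * Re x) + (c + 2 * d + 1)) = 0"
      using res unfolding y by simp
    then have "(2 * Re x)\<^sup>2 + (d + 2) * (2 * Re x) + (c + 2 * d + 1) = 0"
      unfolding of_real_eq_0_iff .
    moreover have "-2 \<le> 2 * Re x" using abs_Re_le_cmod[of x] n1 by auto
    ultimately show False using helix_resolvent_not_real[OF cd] by blast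
  qed
  ultimately have "(norm x)\<^sup>2 < 1" by (simp add: r_def)
  then show "norm x < 1" by (simp add: power_less_one_iff abs_square_less_1)
qed

lemma vanishes_geometric:
  fixes A1 A2 x1 x2 :: complex
  assumes "norm x1 < 1" "norm x2 < 1" and v: "\<And>m. \<bar>v m\<bar> \<le> norm (A1 * x1 ^ nat \<bar>m\<bar> + A2 * x2 ^ nat \<bar>m\<bar>)"
  shows "vanishes_at_infinity v"
  unfolding vanishes_at_infinity_def
proof (intro allI impI)
  fix \<epsilon> :: real assume \<epsilon>: "0 < \<epsilon>"
  have "(\<lambda>k. A1 * x1 ^ k + A2 * x2 ^ k) \<longlonglongrightarrow> A1 * 0 + A2 * 0"
    by (intro tendsto_intros LIMSEQ_power_zero assms)
  then obtain K where K: "\<And>k. K \<le> k \<Longrightarrow> norm (A1 * x1 ^ k + A2 * x2 ^ k) < \<epsilon>"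
    using LIMSEQ_D[OF _ \<epsilon>] by fastforce
  show "\<exists>N. \<forall>l. N \<le> \<bar>l\<bar> \<longrightarrow> \<bar>v l\<bar> \<le> \<epsilon>"
  proof (intro exI[of _ "int K"] allI impI)
    fix l :: int assume "int K \<le> \<bar>l\<bar>"
    then have "K \<le> nat \<bar>l\<bar>" by linarith
    from less_imp_le[OF K[OF this]] show "\<bar>v l\<bar> \<le> \<epsilon>" using v[of l] by linarith
  qed
qed

text \<open>
  Away from the origin the recurrence vanishes because \<open>x\<close> is a root of its characteristic
  polynomial. At \<open>i = 0\<close> and \<open>i = 1\<close>, \<open>i = -1\<close> the window straddles the origin, where
  \<open>x ^ nat \<bar>m\<bar>\<close> differs from \<open>x powi m\<close> by multiples of \<open>x - 1 / x\<close>.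
\<close>
lemma two_sided_geometric_operator:
  fixes a b A x :: complex and p :: "int \<Rightarrow> complex"
  assumes x0: "x \<noteq> 0" and root: "x ^ 4 + a * x ^ 3 + b * x\<^sup>2 + a * x + 1 = 0"
    and p: "\<And>m. p m = A * x ^ nat \<bar>m\<bar>"
  shows "p (i - 2) + a * p (i - 1) + b * p i + a * p (i + 1) + p (i + 2) =
    (if i = 0 then A * (x - inverse x) * (x + inverse x + a)
     else if \<bar>i\<bar> = 1 then A * (x - inverse x) else 0)"
proof -
  have sym: "p (- m) = p m" for m by (simp add: p)
  have rec: "p (k - 2) + a * p (k - 1) + b * p k + a * p (k + 1) + p (k + 2) = 0" if "2 \<le> k" for k
  proof -
    define n where "n = nat (k - 2)"
    have e: "nat \<bar>k - 2\<bar> = n" "nat \<bar>k - 1\<bar> = n + 1" "nat \<bar>k\<bar> = n + 2" "nat \<bar>k + 1\<bar> = n + 3" "nat \<bar>k + 2\<bar> = n + 4"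
      using that by (auto simp: n_def)
    have "p (k - 2) + a * p (k - 1) + b * p k + a * p (k + 1) + p (k + 2) =
        A * x ^ n * (x ^ 4 + a * x ^ 3 + b * x\<^sup>2 + a * x + 1)"
      unfolding p e power_add by (simp add: algebra_simps)
    then show ?thesis by (simp add: root)
  qed
  have one: "p (1 - 2) + a * p (1 - 1) + b * p 1 + a * p (1 + 1) + p (1 + 2) = A * (x - inverse x)"
  proof -
    have "x * (p (1 - 2) + a * p (1 - 1) + b * p 1 + a * p (1 + 1) + p (1 + 2)) =
        A * (x\<^sup>2 - 1 + (x ^ 4 + a * x ^ 3 + b * x\<^sup>2 + a * x + 1))"
      by (simp add: p algebra_simps eval_nat_numeral)
    also have "\<dots> = x * (A * (x - inverse x))"
    proof -
      have "x * (x - inverse x) = x\<^sup>2 - 1" using x0 by (simp add: algebra_simps power2_eq_square)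
      then show ?thesis unfolding root by (simp add: mult.left_commute)
    qed
    finally show ?thesis using x0 by (metis mult_cancel_left)
  qed
  have zero: "p (0 - 2) + a * p (0 - 1) + b * p 0 + a * p (0 + 1) + p (0 + 2) =
      A * (x - inverse x) * (x + inverse x + a)"
  proof -
    have "x\<^sup>2 * (p (0 - 2) + a * p (0 - 1) + b * p 0 + a * p (0 + 1) + p (0 + 2)) =
        A * ((x\<^sup>2 - 1) * (x\<^sup>2 + 1 + a * x) + (x ^ 4 + a * x ^ 3 + b * x\<^sup>2 + a * x + 1))"
      by (simp add: p algebra_simps eval_nat_numeral)
    also have "\<dots> = x\<^sup>2 * (A * (x - inverse x) * (x + inverse x + a))"
    proof -
      have "x * (x - inverse x) = x\<^sup>2 - 1" "x * (x + inverse x + a) = x\<^sup>2 + 1 + a * x"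
        using x0 by (simp_all add: algebra_simps power2_eq_square)
      then have "(x\<^sup>2 - 1) * (x\<^sup>2 + 1 + a * x) = x\<^sup>2 * ((x - inverse x) * (x + inverse x + a))"
        by (metis (no_types, lifting) mult.assoc mult.left_commute power2_eq_square)
      then show ?thesis by (simp add: root mult_ac)
    qed
    finally show ?thesis using x0 by (metis mult_cancel_left power_not_zero)
  qed
  consider "2 \<le> i" | "i \<le> -2" | "i = 1" | "i = -1" | "i = 0" by linarith
  then show ?thesis
  proof cases
    case 1
    then show ?thesis using rec[OF 1] by auto
  next
    case 2
    have "p (- i - 2) + a * p (- i - 1) + b * p (- i) + a * p (- i + 1) + p (- i + 2) = 0"
      using 2 by (intro rec) auto
    moreover have "- i - 2 = - (i + 2)" "- i - 1 = - (i + 1)" "- i + 1 = - (i - 1)" "- i + 2 = - (i - 2)"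
      by simp_all
    ultimately have "p (i + 2) + a * p (i + 1) + b * p i + a * p (i - 1) + p (i - 2) = 0"
      by (simp only: sym)
    then show ?thesis using 2 by (simp add: algebra_simps)
  next
    case 3
    then show ?thesis using one by simp
  next
    case 4
    have "p (-1 - 2) + a * p (-1 - 1) + b * p (-1) + a * p (-1 + 1) + p (-1 + 2) = A * (x - inverse x)"
      using one sym[of 1] sym[of 2] sym[of 3] by (simp add: algebra_simps)
    then show ?thesis using 4 by simp
  next
    case 5
    then show ?thesis using zero by simp
  qed
qed

text \<open>
  The numbers \<open>s1\<close>, \<open>s2\<close> are the two roots of the quadratic for \<open>x + 1 / x\<close>. Both have negative real part because
  the discriminant is smaller than \<open>(d + 2)\<^sup>2\<close>.
\<close>
lemma helix_roots:
  assumes cd: "0 < c" "0 \<le> d"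
  defines "x1 \<equiv> helix_x1 c d" and "x2 \<equiv> helix_x2 c d"
  obtains s1 s2 where "x1 \<noteq> 0" "x2 \<noteq> 0" "norm x1 < 1" "norm x2 < 1"
    "x1 + inverse x1 = s1" "x2 + inverse x2 = s2"
    "s1 + s2 = - (complex_of_real d + 2)" "s1 * s2 = complex_of_real (c + 2 * d + 1)"
    "s1 - s2 = csqrt (complex_of_real (d\<^sup>2 - 4 * d - 4 * c))"
proof -
  define q where "q = csqrt (complex_of_real (d\<^sup>2 - 4 * d - 4 * c))"
  have q2: "q\<^sup>2 = complex_of_real (d\<^sup>2 - 4 * d - 4 * c)" by (simp add: q_def)
  have q0: "0 \<le> Re q"
    using csqrt_principal[of "complex_of_real (d\<^sup>2 - 4 * d - 4 * c)"] unfolding q_def by linarith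
  have qd: "Re q < d + 2"
  proof (cases "0 \<le> d\<^sup>2 - 4 * d - 4 * c")
    case True
    then have "Re q = sqrt (d\<^sup>2 - 4 * d - 4 * c)" by (simp add: q_def)
    also have "\<dots> < sqrt ((d + 2)\<^sup>2)"
      using cd by (intro real_sqrt_less_mono) (simp add: power2_eq_square algebra_simps)
    finally show ?thesis using cd by simp
  next
    case False
    then have "Re q = 0" unfolding q_def by (subst csqrt_of_real_nonpos) auto
    then show ?thesis using cd by simp
  qed
  define u1 where "u1 = - complex_of_real d - 2 + q"
  define u2 where "u2 = - complex_of_real d - 2 - q"
  have x1: "x1 = u1 / 4 + csqrt (u1\<^sup>2 - 16) / 4" and x2: "x2 = u2 / 4 + csqrt (u2\<^sup>2 - 16) / 4"
    by (simp_all add: x1_def x2_def helix_x1_def helix_x2_def Let_def u1_def u2_def q_def)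
  have res: "(u / 2)\<^sup>2 + (d + 2) * (u / 2) + (c + 2 * d + 1) = 0"
    if "u = - complex_of_real d - 2 + q \<or> u = - complex_of_real d - 2 - q" for u :: complex
  proof -
    have "(u / 2)\<^sup>2 + (d + 2) * (u / 2) + (c + 2 * d + 1) =
        ((u + complex_of_real d + 2)\<^sup>2 - complex_of_real (d\<^sup>2 - 4 * d - 4 * c)) / 4"
      by (simp add: field_simps power2_eq_square)
    moreover have "(u + complex_of_real d + 2)\<^sup>2 = q\<^sup>2" using that by auto
    ultimately show ?thesis by (simp add: q2)
  qed
  have "Re u1 < 0" "Re u2 < 0" using q0 qd cd by (simp_all add: u1_def u2_def)
  note p1 = joukowski_root_in_disc[OF cd this(1) _ x1] and p2 = joukowski_root_in_disc[OF cd this(2) _ x2]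
  show ?thesis
  proof (rule that[of "u1 / 2" "u2 / 2"])
    show "x1 \<noteq> 0" "norm x1 < 1" "x1 + inverse x1 = u1 / 2"
      by (rule p1, rule res, simp add: u1_def)+
    show "x2 \<noteq> 0" "norm x2 < 1" "x2 + inverse x2 = u2 / 2"
      by (rule p2, rule res, simp add: u2_def)+
    show "u1 / 2 + u2 / 2 = - (complex_of_real d + 2)"
      by (simp add: u1_def u2_def field_simps)
    have "u1 / 2 * (u2 / 2) = ((complex_of_real d + 2)\<^sup>2 - q\<^sup>2) / 4"
      by (simp add: u1_def u2_def field_simps power2_eq_square)
    also have "\<dots> = complex_of_real (c + 2 * d + 1)"
      unfolding q2 by (simp add: field_simps power2_eq_square)
    finally show "u1 / 2 * (u2 / 2) = complex_of_real (c + 2 * d + 1)" .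
    show "u1 / 2 - u2 / 2 = csqrt (complex_of_real (d\<^sup>2 - 4 * d - 4 * c))"
      unfolding u1_def u2_def q_def[symmetric] by (simp add: field_simps)
  qed
qed

lemma helix_g_factor:
  assumes s: "s1 + s2 = - (complex_of_real d + 2)" "s1 * s2 = complex_of_real (c + 2 * d + 1)"
  shows "poly (helix_g c d) x = (x\<^sup>2 - s1 * x + 1) * (x\<^sup>2 - s2 * x + 1) / c"
proof -
  have "(x\<^sup>2 - s1 * x + 1) * (x\<^sup>2 - s2 * x + 1) =
      x ^ 4 - (s1 + s2) * x ^ 3 + (s1 * s2 + 2) * x\<^sup>2 - (s1 + s2) * x + 1"
    by (simp add: algebra_simps eval_nat_numeral)
  also have "\<dots> = x ^ 4 + (d + 2) * x ^ 3 + (c + 2 * d + 3) * x\<^sup>2 + (d + 2) * x + 1"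
    unfolding s by (simp add: algebra_simps)
  finally show ?thesis by (simp add: poly_helix_g)
qed

text \<open>
  The other root is \<open>inverse x\<close>, which lies outside the unit disc.
\<close>
lemma quadratic_small_root:
  fixes x y s :: complex
  assumes "x \<noteq> 0" "norm x < 1" "x + inverse x = s" and "norm y < 1"
  shows "y\<^sup>2 - s * y + 1 = 0 \<longleftrightarrow> y = x"
proof -
  have "y\<^sup>2 - s * y + 1 = (y - x) * (y - inverse x)"
    using assms(1) unfolding assms(3)[symmetric] by (simp add: algebra_simps power2_eq_square)
  moreover have "y \<noteq> inverse x"
  proof
    assume "y = inverse x"
    then have "norm y * norm x = 1" using assms(1) by (simp add: norm_inverse)
    moreover have "norm y * norm x < 1 * 1"
      using assms by (intro mult_strict_mono') auto
    ultimately show False by simp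
  qed
  ultimately show ?thesis by auto
qed

lemma helix_g_small_roots:
  assumes cd: "0 < c" "0 \<le> d"
  shows "{x. poly (helix_g c d) x = 0 \<and> norm x < 1} = {helix_x1 c d, helix_x2 c d}"
proof -
  obtain s1 s2 where s: "helix_x1 c d \<noteq> 0" "helix_x2 c d \<noteq> 0" "norm (helix_x1 c d) < 1" "norm (helix_x2 c d) < 1"
    "helix_x1 c d + inverse (helix_x1 c d) = s1" "helix_x2 c d + inverse (helix_x2 c d) = s2"
    "s1 + s2 = - (complex_of_real d + 2)" "s1 * s2 = complex_of_real (c + 2 * d + 1)"
    using helix_roots[OF cd] by metis
  show ?thesis
    using cd(1) s(3,4) quadratic_small_root[OF s(1,3,5)] quadratic_small_root[OF s(2,4,6)]
    by (auto simp: helix_g_factor[OF s(7,8)])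
qed

lemma pderiv_helix_g_at_root:
  assumes x0: "x \<noteq> 0" and x: "x + inverse x = s"
    and s: "s + t = - (complex_of_real d + 2)" "s * t = complex_of_real (c + 2 * d + 1)"
  shows "poly (pderiv (helix_g c d)) x = x * ((x - inverse x) * (s - t)) / c"
proof -
  have sx: "s * x = x\<^sup>2 + 1" using x0 unfolding x[symmetric] by (simp add: algebra_simps power2_eq_square)
  have "4 * x ^ 3 + 3 * (d + 2) * x\<^sup>2 + 2 * (c + 2 * d + 3) * x + (d + 2) =
      4 * x ^ 3 - 3 * (s + t) * x\<^sup>2 + 2 * (s * t + 2) * x - (s + t)"
    unfolding s by (simp add: algebra_simps)
  also have "\<dots> = (2 * x - s) * (x\<^sup>2 - t * x + 1) + (x\<^sup>2 - s * x + 1) * (2 * x - t)"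
    by (simp add: algebra_simps eval_nat_numeral)
  also have "\<dots> = (2 * x - s) * (s * x - t * x)" unfolding sx by simp
  also have "2 * x - s = x - inverse x" unfolding x[symmetric] by simp
  finally show ?thesis by (simp add: poly_pderiv_helix_g algebra_simps)
qed

section \<open>Explicit coefficients and the determinantal process\<close>

text \<open>
  The right-hand side solves the same equation as the Fourier coefficients and also decays, so
  the two agree by uniqueness. With \<open>A\<close> denoting the amplitude \<open>x / g'(x)\<close>, the products
  \<open>A * (x - 1 / x)\<close> at the two roots are \<open>c / (s1 - s2)\<close> and its negative. They cancel at
  \<open>i = 1\<close> and \<open>i = -1\<close>, and at \<open>i = 0\<close> they add up to \<open>c\<close>. Uniqueness concerns real sequences,
  so real and imaginary parts are treated separately.
\<close>
lemma helix_coefficient_explicit: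
  assumes cd: "0 < c" "0 \<le> d" and disc: "d\<^sup>2 - 4 * d - 4 * c \<noteq> 0"
  shows "helix_x1 c d \<noteq> helix_x2 c d"
    and "complex_of_real (helix_coefficient c d m) =
            helix_x1 c d / poly (pderiv (helix_g c d)) (helix_x1 c d) * helix_x1 c d ^ nat \<bar>m\<bar>
          + helix_x2 c d / poly (pderiv (helix_g c d)) (helix_x2 c d) * helix_x2 c d ^ nat \<bar>m\<bar>"
proof -
  define x1 where "x1 = helix_x1 c d"
  define x2 where "x2 = helix_x2 c d"
  obtain s1 s2 where s: "x1 \<noteq> 0" "x2 \<noteq> 0" "norm x1 < 1" "norm x2 < 1"
    "x1 + inverse x1 = s1" "x2 + inverse x2 = s2"
    "s1 + s2 = - (complex_of_real d + 2)" "s1 * s2 = complex_of_real (c + 2 * d + 1)"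
    "s1 - s2 = csqrt (complex_of_real (d\<^sup>2 - 4 * d - 4 * c))"
    unfolding x1_def x2_def using helix_roots[OF cd] by metis
  have s12: "s1 \<noteq> s2" using s(9) disc by (metis csqrt_eq_0 eq_iff_diff_eq_0 of_real_eq_0_iff)
  then show "helix_x1 c d \<noteq> helix_x2 c d" using s(5,6) unfolding x1_def x2_def by auto
  define A1 where "A1 = x1 / poly (pderiv (helix_g c d)) x1"
  define A2 where "A2 = x2 / poly (pderiv (helix_g c d)) x2"
  have s': "s2 + s1 = - (complex_of_real d + 2)" "s2 * s1 = complex_of_real (c + 2 * d + 1)"
    using s(7,8) by (simp_all add: ac_simps)
  have ne: "x - inverse x \<noteq> 0" if "x \<noteq> 0" "norm x < 1" for x :: complex
  proof
    assume "x - inverse x = 0"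
    then have "x * x = 1" using that(1) by (simp add: field_simps)
    then have "norm x * norm x = 1" by (metis norm_mult norm_one)
    moreover have "norm x * norm x < 1 * 1" using that(2) by (intro mult_strict_mono') auto
    ultimately show False by simp
  qed
  have a1: "A1 * (x1 - inverse x1) = c / (s1 - s2)"
    unfolding A1_def pderiv_helix_g_at_root[OF s(1,5,7,8)]
    using s(1) s12 ne[OF s(1,3)] cd(1) by (simp add: divide_simps)
  have a2: "A2 * (x2 - inverse x2) = - (c / (s1 - s2))"
    unfolding A2_def pderiv_helix_g_at_root[OF s(2,6) s']
    using s(2) s12 ne[OF s(2,4)] cd(1) by (simp add: divide_simps) (simp add: algebra_simps)
  define p where "p m = A1 * x1 ^ nat \<bar>m\<bar> + A2 * x2 ^ nat \<bar>m\<bar>" for m :: int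
  have root: "x ^ 4 + (d + 2) * x ^ 3 + (c + 2 * d + 3) * x\<^sup>2 + (d + 2) * x + 1 = 0"
    if "x = x1 \<or> x = x2" for x :: complex
  proof -
    have "poly (helix_g c d) x = 0"
      using helix_g_small_roots[OF cd] that unfolding x1_def x2_def by blast
    then show ?thesis using cd(1) by (simp add: poly_helix_g)
  qed
  have op: "p (i - 2) + complex_of_real (d + 2) * p (i - 1) + complex_of_real (c + 2 * d + 3) * p i
      + complex_of_real (d + 2) * p (i + 1) + p (i + 2) = (if i = 0 then c else 0)" for i
  proof -
    define p1 where "p1 m = A1 * x1 ^ nat \<bar>m\<bar>" for m :: int
    define p2 where "p2 m = A2 * x2 ^ nat \<bar>m\<bar>" for m :: int
    let ?a = "complex_of_real (d + 2)" and ?b = "complex_of_real (c + 2 * d + 3)"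
    have op1: "p1 (i - 2) + ?a * p1 (i - 1) + ?b * p1 i + ?a * p1 (i + 1) + p1 (i + 2) =
      (if i = 0 then A1 * (x1 - inverse x1) * (x1 + inverse x1 + ?a)
       else if \<bar>i\<bar> = 1 then A1 * (x1 - inverse x1) else 0)"
      by (rule two_sided_geometric_operator[OF s(1) _ p1_def]) (use root in simp)
    have op2: "p2 (i - 2) + ?a * p2 (i - 1) + ?b * p2 i + ?a * p2 (i + 1) + p2 (i + 2) =
      (if i = 0 then A2 * (x2 - inverse x2) * (x2 + inverse x2 + ?a)
       else if \<bar>i\<bar> = 1 then A2 * (x2 - inverse x2) else 0)"
      by (rule two_sided_geometric_operator[OF s(2) _ p2_def]) (use root in simp)
    have "p (i - 2) + ?a * p (i - 1) + ?b * p i + ?a * p (i + 1) + p (i + 2) =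
      (p1 (i - 2) + ?a * p1 (i - 1) + ?b * p1 i + ?a * p1 (i + 1) + p1 (i + 2))
      + (p2 (i - 2) + ?a * p2 (i - 1) + ?b * p2 i + ?a * p2 (i + 1) + p2 (i + 2))"
      by (simp add: p_def p1_def p2_def algebra_simps)
    also have "\<dots> = (if i = 0 then c / (s1 - s2) * (s1 - s2) else 0)"
      unfolding op1 op2 a1 a2 s(5,6) by (simp add: algebra_simps diff_divide_distrib)
    also have "\<dots> = (if i = 0 then c else 0)" using s12 by simp
    finally show ?thesis .
  qed
  have "(\<lambda>m. Re (p m)) = helix_coefficient c d"
  proof (rule helix_operator_unique[OF cd, where \<kappa> = c])
    show "vanishes_at_infinity (\<lambda>m. Re (p m))"
      by (rule vanishes_geometric[OF s(3,4), of _ A1 A2]) (simp only: p_def abs_Re_le_cmod)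
    show "helix_operator c d (\<lambda>m. Re (p m)) i = (if i = 0 then c else 0)" for i
      using arg_cong[OF op[of i], of Re] by (simp add: helix_operator_def)
  qed (use phased_coefficient_vanishes[OF cd] helix_operator_phased[OF cd]
        in \<open>simp_all add: helix_coefficient_def\<close>)
  moreover have "(\<lambda>m. Im (p m)) = (\<lambda>_. 0)"
  proof (rule helix_operator_unique[OF cd, where \<kappa> = 0])
    show "vanishes_at_infinity (\<lambda>m. Im (p m))"
      by (rule vanishes_geometric[OF s(3,4), of _ A1 A2]) (simp only: p_def abs_Im_le_cmod)
    show "helix_operator c d (\<lambda>m. Im (p m)) i = (if i = 0 then 0 else 0)" for i
      using arg_cong[OF op[of i], of Im] by (simp add: helix_operator_def)
  qed (auto simp: vanishes_at_infinity_def helix_operator_def)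
  ultimately have "complex_of_real (helix_coefficient c d m) = p m"
    by (simp add: complex_eq_iff fun_eq_iff)
  then show "complex_of_real (helix_coefficient c d m) =
            helix_x1 c d / poly (pderiv (helix_g c d)) (helix_x1 c d) * helix_x1 c d ^ nat \<bar>m\<bar>
          + helix_x2 c d / poly (pderiv (helix_g c d)) (helix_x2 c d) * helix_x2 c d ^ nat \<bar>m\<bar>"
    by (simp add: p_def A1_def A2_def x1_def x2_def)
qed

lemma edge_event_sets:
  assumes "e \<in> E"
  shows "{F \<in> space (edge_configs E). e \<in> F} \<in> sets (edge_configs E)"
  unfolding edge_configs_def using assms
  by (auto simp: space_measure_of_conv sets_measure_of_conv)

theorem theorem1p10:
  fixes c d :: real
    and M :: "'a measure"
    and T :: "'a \<Rightarrow> int set set"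
    and X :: "int \<Rightarrow> 'a \<Rightarrow> real"
  assumes "0 < c" and "0 \<le> d"
    and "prob_space M"
    and "T \<in> measurable M (edge_configs helix_edges)"
    and "helix_wst_measure c d (distr M (edge_configs helix_edges) T)"
    and "\<And>m \<omega>. X m \<omega> = (if z_edge m \<in> T \<omega> then 1 else 0)"
  shows "\<exists>fhat :: int \<Rightarrow> real.
      determinantal_process M X (\<lambda>k l. complex_of_real (fhat (l - k))) \<and>
      (\<forall>m. fhat (- m) = fhat m) \<and>
      (d\<^sup>2 - 4 * d - 4 * c \<noteq> 0 \<longrightarrow>
         helix_x1 c d \<noteq> helix_x2 c d \<and>
         (\<forall>m. complex_of_real (fhat m) =
            helix_x1 c d / poly (pderiv (helix_g c d)) (helix_x1 c d)
              * helix_x1 c d ^ nat \<bar>m\<bar>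
            + helix_x2 c d / poly (pderiv (helix_g c d)) (helix_x2 c d)
              * helix_x2 c d ^ nat \<bar>m\<bar>)) \<and>
      {x. poly (helix_g c d) x = 0 \<and> norm x < 1} = {helix_x1 c d, helix_x2 c d} \<and>
      fourier_transform_of (\<lambda>m. complex_of_real (fhat m)) (helix_f c d)"
proof (intro exI[of _ "helix_coefficient c d"] conjI impI allI)
  note cd = assms(1,2) and T = assms(4) and X = assms(6)
  let ?N = "edge_configs helix_edges"
  have edge: "{F \<in> space ?N. z_edge m \<in> F} \<in> sets ?N" for m
    by (rule edge_event_sets) (simp add: helix_edges_def)
  have symm: "helix_coefficient c d (i - j) = helix_coefficient c d (j - i)" for i j
    using helix_coefficient_minus[of c d "i - j"] by simp
  show "determinantal_process M X (\<lambda>k l. complex_of_real (helix_coefficient c d (l - k)))"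
    unfolding determinantal_process_def
  proof (intro conjI allI impI ballI)
    fix m
    have "T -` {F \<in> space ?N. z_edge m \<in> F} \<inter> space M \<in> sets M"
      by (rule measurable_sets[OF T edge])
    also have "T -` {F \<in> space ?N. z_edge m \<in> F} \<inter> space M = {\<omega> \<in> space M. z_edge m \<in> T \<omega>}"
      using measurable_space[OF T] by auto
    finally have "{\<omega> \<in> space M. z_edge m \<in> T \<omega>} \<in> sets M" .
    then show "X m \<in> borel_measurable M"
      unfolding X[abs_def] by (intro measurable_If) auto
    show "X m \<omega> \<in> {0, 1}" for \<omega> by (simp add: X)
  next
    fix i j
    show "complex_of_real (helix_coefficient c d (i - j)) =
        cnj (complex_of_real (helix_coefficient c d (j - i)))"
      using symm[of i j] by simp
  next
    fix S :: "int set" assume S: "finite S"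
    let ?A = "{F \<in> space ?N. z_edge ` S \<subseteq> F}"
    have "?A = space ?N \<inter> (\<Inter>m\<in>S. {F \<in> space ?N. z_edge m \<in> F})" by auto
    also have "\<dots> \<in> sets ?N" using S edge by (induction S rule: finite_induct) auto
    finally have A: "?A \<in> sets ?N" .
    have "{\<omega> \<in> space M. \<forall>s\<in>S. X s \<omega> = 1} = T -` ?A \<inter> space M"
      using measurable_space[OF T] by (auto simp: X split: if_splits)
    then have "measure M {\<omega> \<in> space M. \<forall>s\<in>S. X s \<omega> = 1} = measure (distr M ?N T) ?A"
      using measure_distr[OF T A] by simp
    also have "\<dots> = idx_det S (\<lambda>i j. helix_coefficient c d (j - i))"
      using helix_wst_path_edges[OF cd assms(5) _ _ S, of "helix_coefficient c d"]
        phased_coefficient_vanishes[OF cd] helix_operator_phased[OF cd]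
      by (simp add: helix_coefficient_def)
    finally show "complex_of_real (measure M {\<omega> \<in> space M. \<forall>s\<in>S. X s \<omega> = 1}) =
        Determinant.det (principal_submatrix (\<lambda>k l. complex_of_real (helix_coefficient c d (l - k))) S)"
      by (simp add: det_principal_submatrix[OF S] idx_det_of_real)
  qed
qed (use assms(1,2) helix_coefficient_minus helix_coefficient_explicit helix_g_small_roots fourier_helix
      in auto)

end
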